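(* Let $j$ be an integer. If $\theta^*\le j+1$, then $$\lim_{n\to\infty}\frac{\zeta_{n,j}}{\ln n}=\frac{1}{\mathsf m_*}\qquad\text{a.s.}$$
   Context: Notation: $\mathbb N=\{1,2,\dots\}$, $\mathbb Z_+=\{0,1,2,\dots\}$, $\mathbb N^0=\{\varnothing\}$. Splitting law. $\mathrm{Prob}_{\mathbb N}$ is the set of probability measures on $\mathbb N$, identified with sequences $(p_j)_{j\in\mathbb N}$ of nonnegative reals with sum $1$. Fix a probability measure $\nu$ on $\mathrm{Prob}_{\mathbb N}$ and let $\boldsymbol\varrho=(\varrho_j)_{j\in\mathbb N}$ be a random element with law $\nu$. Standing assumption: $\nu$ is not geometric, i.e. there is no real $r>0$ such that with probability one all the atoms (the positive masses $\varrho_j$) of $\boldsymbol\varrho$ belong to $\{r^n: n\in\mathbb Z_+\}$. Multiplicative cascade. Let $\mathcal T=\bigcup_{k\ge0}\mathbb N^k$ and let $(\boldsymbol\varrho(i))_{i\in\mathcal T}$ be independent copies of $\boldsymbol\varrho$. For $i=(i_1,\dots,i_k)\in\mathbb N^k$ write $i^{(k')}=(i_1,\dots,i_{k'})$ for $k'\le k$ (with $i^{(0)}=\varnothing$) and $$p_i(k)=\varrho_{i_1}(\varnothing)\,\varrho_{i_2}(i^{(1)})\cdots\varrho_{i_k}(i^{(k-1)}),$$ so $\mathbf p(k)=(p_i(k))_{i\in\mathbb N^k}$ is a random probability measure on $\mathbb N^k$. Let $\partial\mathcal T=\mathbb N^{\mathbb N}$, and for $i\in\mathbb N^k$ let $\partial\mathcal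 T_i$ be the set of sequences in $\partial\mathcal T$ whose first $k$ terms form $i$. Let $\mathbf P$ be the random probability measure on $\partial\mathcal T$ with $\mathbf P(\partial\mathcal T_i)=p_i(k)$ for all $k$ and $i\in\mathbb N^k$. Occupancy scheme. Conditionally on $\mathbf P$, let $\lambda_{(1)},\lambda_{(2)},\dots$ be i.i.d. random elements of $\partial\mathcal T$ with law $\mathbf P$ (the "balls"); an index $i\in\mathbb N^k$ is a "box" at generation $k$. $\bar N^{(k)}_{n,j}$ is the number of boxes $i\in\mathbb N^k$ containing more than $j$ of the first $n$ balls, i.e. such that more than $j$ indices $m\le n$ satisfy $\lambda_{(m)}\in\partial\mathcal T_i$. Define $$\zeta_{n,j}=\min\{k\in\mathbb N:\bar N^{(k)}_{n,j}=0\},$$ the lowest generation at which no box contains more than $j$ of the first $n$ balls. Analytic quantities. For $\theta>0$, $\mathsf l(\theta)=\mathbb E\big(\sum_{j\in\mathbb N}\varrho_j^{\theta}\big)\in(0,\infty]$ (with $0^\theta=0$); $\theta_*=\inf\{\theta>0:\mathsf l(\theta)<\infty\}$. For $\theta>\theta_*$, $$\varphi(\theta)=\ln\mathsf l(\theta)-\theta\frac{\mathsf l'(\theta)}{\mathsf l(\theta)},\quad \mathsf m(\theta)=-\frac{\mathsf l'(\theta)}{\mathsf l(\theta)},$$ $\theta^*=\sup\{\theta>\theta_*:\varphi(\theta)>0\}\in(1,\infty]$, and $\mathsf m_*=\lim_{\theta\to\theta^*-}\mathsf m(\theta)$. *)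

theory Defs
  imports "HOL-Probability.Probability"
begin

text \<open>
  Labels are shifted by one: children of a node and balls are numbered \<open>0, 1, 2, \<dots>\<close>, so
  \<open>p j\<close> stands for $p_{j+1}$ and \<open>lam m\<close> for the ball number $m+1$.
  Generations are not shifted.
\<close>

definition prob_seqs :: "(nat \<Rightarrow> real) set" where
  "prob_seqs = {p. (\<forall>j. 0 \<le> p j) \<and> p sums 1}"

definition Prob_N :: "(nat \<Rightarrow> real) measure" where
  "Prob_N = restrict_space (Pi\<^sub>M UNIV (\<lambda>_. borel)) prob_seqs"

definition geometric_law :: "(nat \<Rightarrow> real) measure \<Rightarrow> bool" where
  "geometric_law \<nu> \<longleftrightarrow>
     (\<exists>r>0. AE p in \<nu>. \<forall>j. 0 < p j \<longrightarrow> (\<exists>n::nat. p j = r ^ n))"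

text \<open>The convention \<open>0 powr \<theta> = 0\<close> of the library is the one needed here.\<close>

definition ell :: "(nat \<Rightarrow> real) measure \<Rightarrow> real \<Rightarrow> ennreal" where
  "ell \<nu> \<theta> = (\<integral>\<^sup>+ p. (\<Sum>j. ennreal (p j powr \<theta>)) \<partial>\<nu>)"

text \<open>The real-valued version is meaningful where \<open>ell\<close> is finite, in particular on the
  open half-line to the right of \<open>theta_low\<close>, where it is differentiated.\<close>

definition ellr :: "(nat \<Rightarrow> real) measure \<Rightarrow> real \<Rightarrow> real" where
  "ellr \<nu> \<theta> = enn2real (ell \<nu> \<theta>)"

definition theta_low :: "(nat \<Rightarrow> real) measure \<Rightarrow> real" where
  "theta_low \<nu> = Inf {\<theta>. 0 < \<theta> \<and> ell \<nu> \<theta> < \<infinity>}"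

definition phi :: "(nat \<Rightarrow> real) measure \<Rightarrow> real \<Rightarrow> real" where
  "phi \<nu> \<theta> = ln (ellr \<nu> \<theta>) - \<theta> * (deriv (ellr \<nu>) \<theta> / ellr \<nu> \<theta>)"

definition mm :: "(nat \<Rightarrow> real) measure \<Rightarrow> real \<Rightarrow> real" where
  "mm \<nu> \<theta> = - (deriv (ellr \<nu>) \<theta> / ellr \<nu> \<theta>)"

definition theta_up :: "(nat \<Rightarrow> real) measure \<Rightarrow> ereal" where
  "theta_up \<nu> = Sup (ereal ` {\<theta>. theta_low \<nu> < \<theta> \<and> phi \<nu> \<theta> > 0})"

text \<open>Taking the left limit in the extended reals covers both finite and infinite
  values of \<open>theta_up\<close>.\<close>

definition mm_lim :: "(nat \<Rightarrow> real) measure \<Rightarrow> real" where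
  "mm_lim \<nu> = Lim (at_left (theta_up \<nu>)) (\<lambda>\<theta>. mm \<nu> (real_of_ereal \<theta>))"

text \<open>Nodes of the tree are lists, and the prefix $i^{(k)}$ is \<open>take k i\<close>.\<close>

definition cascade_mass :: "(nat list \<Rightarrow> 'w \<Rightarrow> nat \<Rightarrow> real) \<Rightarrow> 'w \<Rightarrow> nat list \<Rightarrow> real" where
  "cascade_mass rho \<omega> i = (\<Prod>l<length i. rho (take l i) \<omega> (i ! l))"

definition boundary :: "(nat \<Rightarrow> nat) measure" where
  "boundary = Pi\<^sub>M UNIV (\<lambda>_. count_space UNIV)"

definition cylinder :: "nat list \<Rightarrow> (nat \<Rightarrow> nat) set" where
  "cylinder i = {x. \<forall>l<length i. x l = i ! l}"

definition cond_iid ::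
  "'w measure \<Rightarrow> 'a measure \<Rightarrow> ('w \<Rightarrow> 'a measure) \<Rightarrow> (nat \<Rightarrow> 'w \<Rightarrow> 'a) \<Rightarrow> bool" where
  "cond_iid M X P lam \<longleftrightarrow>
     (\<forall>m. lam m \<in> measurable M X) \<and>
     (\<forall>n A. (\<forall>m<n. A m \<in> sets X) \<longrightarrow>
       (AE \<omega> in M.
          real_cond_exp M (vimage_algebra (space M) P (prob_algebra X))
            (indicator {\<omega> \<in> space M. \<forall>m<n. lam m \<omega> \<in> A m}) \<omega>
          = (\<Prod>m<n. measure (P \<omega>) (A m))))"

text \<open>For \<open>j < 0\<close> every box qualifies and \<open>card\<close> takes its default value \<open>0\<close>;
  only \<open>j \<ge> 0\<close> is meaningful.\<close>

definition overfull_boxes ::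
  "(nat \<Rightarrow> 'w \<Rightarrow> nat \<Rightarrow> nat) \<Rightarrow> 'w \<Rightarrow> nat \<Rightarrow> int \<Rightarrow> nat \<Rightarrow> nat" where
  "overfull_boxes lam \<omega> n j k =
     card {i. length i = k \<and> int (card {m. m < n \<and> lam m \<omega> \<in> cylinder i}) > j}"

text \<open>If no such generation exists, the value is \<open>Inf {} = 0\<close>.\<close>

definition zeta :: "(nat \<Rightarrow> 'w \<Rightarrow> nat \<Rightarrow> nat) \<Rightarrow> 'w \<Rightarrow> nat \<Rightarrow> int \<Rightarrow> nat" where
  "zeta lam \<omega> n j = Inf {k. 1 \<le> k \<and> overfull_boxes lam \<omega> n j k = 0}"

end

theory Submission
  imports Defs
begin

text \<open>
  Write \<open>l(\<theta>)\<close> for the moment function \<open>ellr \<nu> \<theta>\<close>, \<open>T\<close> for \<open>theta_up \<nu>\<close> and \<open>m\<close> for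
  \<open>mm_lim \<nu>\<close>.  The limit \<open>m\<close> is the exponential rate at which the largest box mass decays, and a
  box of generation \<open>k\<close> can hold more than \<open>j\<close> of \<open>n\<close> balls as long as \<open>n\<close> times that mass is large.
  So the critical generation solves \<open>n * exp (- m * k) = 1\<close>, that is \<open>k = ln n / m\<close>.

  The exponent \<open>T\<close> is a zero of the continuous function \<open>phi \<nu>\<close>
  (\<open>critical_exponent\<close>), which says \<open>l(T) = exp (- T * m)\<close>: the curve \<open>ln l\<close> and the line of slope
  \<open>- m\<close> through the origin touch at \<open>T\<close>.  This rests on the continuity of the derivative of \<open>l\<close>, a
  consequence of dominated convergence.  Under a non-geometric law, atoms strictly between
  \<open>0\<close> and \<open>1\<close> occur with positive probability, which gives \<open>T > 1\<close> and \<open>m > 0\<close>, and so do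
  splittings with at least two atoms.

  Upper bound.  Given the masses, a box of mass \<open>p\<close> holds more than \<open>j\<close> of \<open>n\<close> balls with
  probability at most \<open>min 1 ((n * p) ^ (j + 1))\<close>, hence at most \<open>(n * p) powr T\<close> because
  \<open>T \<le> j + 1\<close> (\<open>prob_load_gt\<close>).  The expected sum of the \<open>T\<close>-th powers of the masses of
  generation \<open>k\<close> is \<open>l(T) ^ k = exp (- T * m * k)\<close> (\<open>moment_masses\<close>).  For \<open>n = exp (a * k)\<close> with
  \<open>a < m\<close> the probabilities are summable in \<open>k\<close>, and the Borel-Cantelli lemma applies.

  Lower bound.  For \<open>a > m\<close> almost every environment has a constant \<open>c > 0\<close> such that every
  generation \<open>k\<close> contains a box of mass at least \<open>c * exp (- a * k)\<close>.  To see this, pick \<open>\<theta>\<close> near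
  \<open>T\<close> with \<open>phi \<nu> \<theta> > 0\<close>; Chernoff bounds on both sides of the typical mass show that for some
  \<open>K\<close> the expected number of boxes of generation \<open>K\<close> heavier than \<open>exp (- a * K)\<close> exceeds \<open>1\<close>
  (\<open>supercritical_block\<close>).  Such boxes in successive blocks of \<open>K\<close> generations form a supercritical
  branching process, which survives with positive probability by a second moment recursion
  (\<open>prob_heavy_lines_pos\<close>), and a zero-one law raises this probability to one
  (\<open>prob_heavy_lines_zero_one\<close>).  When \<open>n\<close> is exponentially larger than the inverse mass of such
  a box, the box gets more than \<open>j\<close> balls except with summable probability
  (\<open>prob_heavy_box_underfull\<close>).

  Monotonicity in \<open>n\<close> and in the generation turns the two estimates along exponential sequences
  into the limit (\<open>growth_rate_limit\<close>).
\<close>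

section \<open>Random environments on the tree of words\<close>

text \<open>An environment assigns a splitting sequence to every word; this one is the environment seen from the
  vertex \<open>v\<close>, with \<open>v\<close> as the new root.\<close>

definition subenv :: "nat list \<Rightarrow> (nat list \<Rightarrow> nat \<Rightarrow> real) \<Rightarrow> nat list \<Rightarrow> nat \<Rightarrow> real" where
  "subenv v e w = e (v @ w)"

definition mass :: "(nat list \<Rightarrow> nat \<Rightarrow> real) \<Rightarrow> nat list \<Rightarrow> real" where
  "mass e i = (\<Prod>l<length i. e (take l i) (i ! l))"

lemma mass_Nil [simp]: "mass e [] = 1"
  by (simp add: mass_def)

text \<open>The multiplicative structure of the cascade: relative masses inside a box are masses of the environment
  seen from that box.\<close>

lemma mass_append: "mass e (i @ i') = mass e i * mass (subenv i e) i'"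
proof -
  have *: "{..<length i + length i'} = {..<length i} \<union> {length i..<length i + length i'}" by auto
  have "mass e (i @ i') = (\<Prod>l<length i. e (take l (i@i')) ((i@i') ! l)) *
      (\<Prod>l\<in>{length i..<length i + length i'}. e (take l (i@i')) ((i@i') ! l))"
    unfolding mass_def length_append * by (rule prod.union_disjoint) auto
  also have "(\<Prod>l<length i. e (take l (i@i')) ((i@i') ! l)) = mass e i"
    unfolding mass_def by (rule prod.cong) (auto simp: nth_append)
  also have "(\<Prod>l\<in>{length i..<length i + length i'}. e (take l (i@i')) ((i@i') ! l)) =
    (\<Prod>l<length i'. e (take (l + length i) (i@i')) ((i@i') ! (l + length i)))"
    using prod.shift_bounds_nat_ivl[of "\<lambda>l. e (take l (i@i')) ((i@i') ! l)" 0 "length i" "length i'"]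
    by (simp add: add.commute atLeast0LessThan)
  also have "\<dots> = mass (subenv i e) i'"
    unfolding mass_def subenv_def by (rule prod.cong) (auto simp: nth_append)
  finally show ?thesis .
qed

lemma mass_singleton: "mass e [j] = e [] j"
  by (simp add: mass_def)

lemma mass_Cons: "mass e (j # i) = e [] j * mass (subenv [j] e) i"
  using mass_append[of e "[j]" i] by (simp add: mass_singleton)

lemma atom_bounds: assumes "p \<in> prob_seqs" shows "0 \<le> p j" "p j \<le> 1"
proof -
  show "0 \<le> p j" using assms by (auto simp: prob_seqs_def)
  have "(\<Sum>i\<in>{j}. p i) \<le> suminf p"
    using assms by (intro sum_le_suminf) (auto simp: prob_seqs_def sums_iff)
  then show "p j \<le> 1" using assms by (auto simp: prob_seqs_def sums_iff)
qed

locale splitting_law =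
  fixes \<nu> :: "(nat \<Rightarrow> real) measure"
  assumes law: "\<nu> \<in> space (prob_algebra Prob_N)"
begin

lemma sets_law [measurable_cong]: "sets \<nu> = sets Prob_N"
  using law by (simp add: space_prob_algebra)

lemma prob_law: "prob_space \<nu>"
  using law by (simp add: space_prob_algebra)

lemma space_law: "space \<nu> = prob_seqs"
  using sets_eq_imp_space_eq[OF sets_law] by (auto simp: Prob_N_def space_restrict_space space_PiM)

lemma measurable_atom [measurable]: "(\<lambda>p. p j) \<in> borel_measurable \<nu>"
proof -
  have "(\<lambda>p. p j) \<in> borel_measurable Prob_N"
    unfolding Prob_N_def by (rule measurable_restrict_space1) simp
  then show ?thesis
    by (simp cong: measurable_cong_sets add: measurable_cong_sets[OF sets_law refl])
qed

text \<open>The joint law of all splittings.  Working on this canonical space makes the environment seen from a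
  vertex literally equal in law to the whole environment.\<close>

definition env :: "(nat list \<Rightarrow> nat \<Rightarrow> real) measure" where
  "env = Pi\<^sub>M UNIV (\<lambda>_. \<nu>)"

sublocale nu: prob_space \<nu> by (rule prob_law)
sublocale env: product_prob_space "\<lambda>_::nat list. \<nu>" UNIV by unfold_locales
sublocale env: prob_space env unfolding env_def by unfold_locales

lemma space_env: "e \<in> space env \<longleftrightarrow> (\<forall>v. e v \<in> prob_seqs)"
  by (auto simp: env_def space_PiM space_law)

lemma measurable_env_component [measurable]: "(\<lambda>e. e v) \<in> env \<rightarrow>\<^sub>M \<nu>"
  unfolding env_def by (rule measurable_component_singleton) simp

lemma measurable_env_atom [measurable]: "(\<lambda>e. e v j) \<in> borel_measurable env"
  by (rule measurable_compose[OF measurable_env_component measurable_atom])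

lemma distr_env_component: "distr env \<nu> (\<lambda>e. e v) = \<nu>"
  unfolding env_def using env.PiM_component[of v] by simp

lemma indep_env: "env.indep_vars (\<lambda>_. \<nu>) (\<lambda>v e. e v) UNIV"
proof -
  have "distr env (Pi\<^sub>M UNIV (\<lambda>_. \<nu>)) (\<lambda>x. \<lambda>i\<in>UNIV. x i) = env"
    by (simp add: env_def restrict_UNIV distr_id[unfolded id_def])
  then show ?thesis
    by (subst env.indep_vars_iff_distr_eq_PiM')
       (auto simp: distr_env_component env_def[symmetric])
qed

lemma measurable_subenv [measurable]: "subenv v \<in> env \<rightarrow>\<^sub>M env"
  unfolding env_def subenv_def[abs_def]
  by (rule measurable_PiM_single') (auto simp: env_def[symmetric] space_law space_env)

lemma distr_subenv: "distr env env (subenv v) = env"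
proof -
  have "distr (Pi\<^sub>M UNIV (\<lambda>_. \<nu>)) (Pi\<^sub>M UNIV (\<lambda>_. \<nu>)) (\<lambda>e. \<lambda>w\<in>UNIV. e (v @ w)) = Pi\<^sub>M UNIV (\<lambda>_. \<nu>)"
    by (rule distr_PiM_reindex[where f="\<lambda>w. v @ w"]) (auto simp: prob_law inj_on_def)
  then show ?thesis
    by (simp add: env_def subenv_def[abs_def] restrict_UNIV)
qed

lemma subenv_space: "e \<in> space env \<Longrightarrow> subenv v e \<in> space env"
  by (auto simp: space_env subenv_def)

lemma measurable_mass [measurable]: "(\<lambda>e. mass e i) \<in> borel_measurable env"
  unfolding mass_def by measurable

lemma mass_bounds: assumes "e \<in> space env" shows "0 \<le> mass e i" "mass e i \<le> 1"
  using assms unfolding mass_def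
  by (auto intro!: prod_nonneg prod_le_1 simp: space_env atom_bounds)

text \<open>The branching property: the first \<open>K\<close> generations and the environments seen from two distinct vertices of
  generation \<open>K\<close> use three disjoint sets of coordinates of a product measure.\<close>

lemma indep_prefix_subtrees:
  assumes i: "length i = K" "length i' = K" "i \<noteq> i'"
    and A: "A \<in> sets env" "A' \<in> sets env" and R: "R \<in> sets env"
    and Rdep: "\<And>e e'. e \<in> space env \<Longrightarrow> e' \<in> space env \<Longrightarrow> (\<And>w. length w < K \<Longrightarrow> e w = e' w) \<Longrightarrow> e \<in> R \<Longrightarrow> e' \<in> R"
  shows "env.prob (R \<inter> {e\<in>space env. subenv i e \<in> A \<and> subenv i' e \<in> A'}) = env.prob R * env.prob A * env.prob A'"
proof -
  define Ks :: "nat \<Rightarrow> nat list set" where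
    "Ks r = (if r = 0 then {w. length w < K} else if r = 1 then range ((@) i) else range ((@) i'))" for r
  have disj: "disjoint_family_on Ks {0,1,2}"
    using i by (auto simp: disjoint_family_on_def Ks_def)
  have ind: "env.indep_vars (\<lambda>r. Pi\<^sub>M (Ks r) (\<lambda>_. \<nu>)) (\<lambda>r e. restrict e (Ks r)) {0,1,2}"
    using env.indep_vars_restrict[OF indep_env _ disj] by simp
  obtain p0 where p0: "p0 \<in> space \<nu>" using nu.not_empty by blast
  define Y :: "nat \<Rightarrow> (nat list \<Rightarrow> nat \<Rightarrow> real) \<Rightarrow> nat list \<Rightarrow> nat \<Rightarrow> real" where
    "Y r f w = (if r = 0 then (if length w < K then f w else p0) else if r = 1 then f (i @ w) else f (i' @ w))" for r f w
  have Y: "Y r \<in> Pi\<^sub>M (Ks r) (\<lambda>_. \<nu>) \<rightarrow>\<^sub>M env" if "r \<in> {0,1,2}" for r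
    unfolding env_def
  proof (rule measurable_PiM_single')
    fix w :: "nat list"
    show "(\<lambda>f. Y r f w) \<in> Pi\<^sub>M (Ks r) (\<lambda>_. \<nu>) \<rightarrow>\<^sub>M \<nu>"
      using that p0 by (cases "length w < K") (auto simp: Y_def Ks_def intro!: measurable_component_singleton)
  qed (use that p0 in \<open>auto simp: space_PiM Y_def Ks_def\<close>)
  have "env.indep_vars (\<lambda>_. env) (\<lambda>r. Y r \<circ> (\<lambda>e. restrict e (Ks r))) {0,1,2}"
    by (rule env.indep_vars_compose[OF ind Y])
  then have ind2: "env.indep_vars (\<lambda>_. env) (\<lambda>r e. Y r (restrict e (Ks r))) {0,1,2}"
    by (simp add: comp_def)
  define B where "B r = (if r = 0 then R else if r = 1 then A else A')" for r :: nat
  have B: "B r \<in> sets env" for r using A R by (auto simp: B_def)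
  have "env.prob (\<Inter>r\<in>{0,1,2}. (\<lambda>e. Y r (restrict e (Ks r))) -` B r \<inter> space env) =
      (\<Prod>r\<in>{0,1,2}. env.prob ((\<lambda>e. Y r (restrict e (Ks r))) -` B r \<inter> space env))"
    by (rule env.indep_varsD[OF ind2]) (auto simp: B)
  moreover have "(\<lambda>e. Y 0 (restrict e (Ks 0))) -` B 0 \<inter> space env = R"
  proof -
    have sp: "Y 0 (restrict e (Ks 0)) \<in> space env" if "e \<in> space env" for e
      using that p0 by (auto simp: Y_def Ks_def space_env space_law)
    have ag: "length w < K \<Longrightarrow> Y 0 (restrict e (Ks 0)) w = e w" for e w
      by (auto simp: Y_def Ks_def)
    \<comment> \<open>Refilling the deeper coordinates with \<open>p0\<close> does not affect membership in \<open>R\<close>.\<close>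
    have "Y 0 (restrict e (Ks 0)) \<in> R \<longleftrightarrow> e \<in> R" if "e \<in> space env" for e
      using Rdep[OF that sp[OF that]] Rdep[OF sp[OF that] that] ag by metis
    then show ?thesis using sets.sets_into_space[OF R] by (auto simp: B_def)
  qed
  moreover have 1: "(\<lambda>e. Y 1 (restrict e (Ks 1))) = subenv i" "(\<lambda>e. Y 2 (restrict e (Ks 2))) = subenv i'"
    by (auto simp: Y_def Ks_def subenv_def fun_eq_iff)
  moreover have pr: "env.prob (subenv v -` C \<inter> space env) = env.prob C" if "C \<in> sets env" for C v
    using measure_distr[OF measurable_subenv that, of v] by (simp add: distr_subenv)
  moreover have "(\<Inter>r\<in>{0,1,2}. (\<lambda>e. Y r (restrict e (Ks r))) -` B r \<inter> space env)
    = ((\<lambda>e. Y 0 (restrict e (Ks 0))) -` B 0 \<inter> space env) \<inter> {e\<in>space env. subenv i e \<in> A \<and> subenv i' e \<in> A'}"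
    by (auto simp: B_def 1[THEN fun_cong, simplified])
  ultimately show ?thesis
    using pr[OF A(1), of i] pr[OF A(2), of i']
    by (simp add: B_def)
qed

end

section \<open>Power moments of the box masses\<close>

lemma countable_lists_of_length [simp]: "countable {i :: 'a :: countable list. length i = k}"
  by (rule countable_subset[OF subset_UNIV]) simp

text \<open>Distributivity for an infinite alphabet: expanding a power of a series gives a sum over words.\<close>

lemma nn_integral_words_prod:
  fixes c :: "nat \<Rightarrow> ennreal"
  shows "(\<integral>\<^sup>+i. (\<Prod>l<length i. c (i ! l)) \<partial>count_space {i. length i = k}) = (\<Sum>j. c j) ^ k"
proof (induction k)
  case 0
  have "{i::nat list. length i = 0} = {[]}" by auto
  then show ?case by (simp add: nn_integral_count_space_finite)
next
  case (Suc k)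
  let ?W = "{i::nat list. length i = k}"
  have bij: "bij_betw (\<lambda>(j, i). j # i) (UNIV \<times> ?W) {i. length i = Suc k}"
    by (auto simp: bij_betw_def inj_on_def length_Suc_conv image_iff)
  interpret sigma_finite_measure "count_space ?W"
    by (rule sigma_finite_measure_count_space_countable) simp
  have "(\<integral>\<^sup>+i. (\<Prod>l<length i. c (i ! l)) \<partial>count_space {i. length i = Suc k}) =
    (\<integral>\<^sup>+z. (case z of (j, i) \<Rightarrow> c j * (\<Prod>l<length i. c (i ! l))) \<partial>count_space (UNIV \<times> ?W))"
    by (subst nn_integral_bij_count_space[OF bij, symmetric])
       (auto intro!: nn_integral_cong simp del: prod.lessThan_Suc simp: prod.lessThan_Suc_shift split: prod.splits)
  also have "\<dots> = (\<integral>\<^sup>+z. (case z of (j, i) \<Rightarrow> c j * (\<Prod>l<length i. c (i ! l))) \<partial>(count_space UNIV \<Otimes>\<^sub>M count_space ?W))"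
    by (simp add: pair_measure_countable)
  also have "\<dots> = (\<integral>\<^sup>+j. \<integral>\<^sup>+i. c j * (\<Prod>l<length i. c (i ! l)) \<partial>count_space ?W \<partial>count_space UNIV)"
    by (subst nn_integral_fst[symmetric]) (auto simp: pair_measure_countable)
  also have "\<dots> = (\<integral>\<^sup>+j. c j * (\<Sum>j. c j) ^ k \<partial>count_space UNIV)"
    by (intro nn_integral_cong) (simp add: nn_integral_cmult Suc.IH)
  also have "\<dots> = (\<Sum>j. c j) ^ Suc k"
    by (simp add: nn_integral_multc nn_integral_count_space_nat)
  finally show ?case .
qed

context splitting_law
begin

text \<open>The splittings along the path to \<open>i\<close> sit at distinct vertices, so they are independent.\<close>

lemma nn_integral_mass_powr:
  "(\<integral>\<^sup>+e. ennreal (mass e i powr \<theta>) \<partial>env) = (\<Prod>l<length i. \<integral>\<^sup>+p. ennreal (p (i ! l) powr \<theta>) \<partial>\<nu>)"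
proof -
  let ?V = "(\<lambda>l. take l i) ` {..<length i}"
  define X where "X v e = ennreal (e v (i ! length v) powr \<theta>)" for v and e :: "nat list \<Rightarrow> nat \<Rightarrow> real"
  have inj: "inj_on (\<lambda>l. take l i) {..<length i}"
  proof (rule inj_onI)
    fix l l' assume l: "l \<in> {..<length i}" "l' \<in> {..<length i}" and eq: "take l i = take l' i"
    have "length (take l i) = length (take l' i)" by (simp only: eq)
    then show "l = l'" using l by simp
  qed
  have "env.indep_vars (\<lambda>_. \<nu>) (\<lambda>v e. e v) ?V"
    by (rule env.indep_vars_subset[OF indep_env]) simp
  then have ind: "env.indep_vars (\<lambda>_. borel) X ?V"
    unfolding X_def by (rule env.indep_vars_compose2) measurable
  have "(\<integral>\<^sup>+e. ennreal (mass e i powr \<theta>) \<partial>env) = (\<integral>\<^sup>+e. (\<Prod>v\<in>?V. X v e) \<partial>env)"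
  proof (rule nn_integral_cong)
    fix e assume e: "e \<in> space env"
    then have "mass e i powr \<theta> = (\<Prod>l<length i. e (take l i) (i ! l) powr \<theta>)"
      unfolding mass_def by (subst prod_powr_distrib) (auto simp: space_env atom_bounds)
    also have "ennreal \<dots> = (\<Prod>l<length i. X (take l i) e)"
      by (subst prod_ennreal[symmetric]) (auto simp: X_def intro!: prod.cong)
    also have "\<dots> = (\<Prod>v\<in>?V. X v e)"
      by (subst prod.reindex[OF inj]) simp
    finally show "ennreal (mass e i powr \<theta>) = (\<Prod>v\<in>?V. X v e)" .
  qed
  also have "\<dots> = (\<Prod>v\<in>?V. \<integral>\<^sup>+e. X v e \<partial>env)"
    by (rule env.indep_vars_nn_integral[OF _ ind]) auto
  also have "\<dots> = (\<Prod>l<length i. \<integral>\<^sup>+e. X (take l i) e \<partial>env)"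
    by (subst prod.reindex[OF inj]) simp
  also have "\<dots> = (\<Prod>l<length i. \<integral>\<^sup>+p. ennreal (p (i ! l) powr \<theta>) \<partial>\<nu>)"
  proof (rule prod.cong[OF refl])
    fix l assume "l \<in> {..<length i}"
    then show "(\<integral>\<^sup>+e. X (take l i) e \<partial>env) = (\<integral>\<^sup>+p. ennreal (p (i ! l) powr \<theta>) \<partial>\<nu>)"
      by (subst (2) distr_env_component[of "take l i", symmetric], subst nn_integral_distr)
         (auto simp: X_def[abs_def])
  qed
  finally show ?thesis .
qed

lemma ell_eq_suminf: "ell \<nu> \<theta> = (\<Sum>j. \<integral>\<^sup>+p. ennreal (p j powr \<theta>) \<partial>\<nu>)"
  unfolding ell_def by (rule nn_integral_suminf) measurable

text \<open>The many-to-one identity: power sums of the masses multiply along generations in the mean.\<close>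

lemma moment_masses:
  "(\<integral>\<^sup>+e. \<integral>\<^sup>+i. ennreal (mass e i powr \<theta>) \<partial>count_space {i. length i = k} \<partial>env) = ell \<nu> \<theta> ^ k"
  by (subst nn_integral_count_space_nn_integral)
     (auto simp: nn_integral_mass_powr ell_eq_suminf
        nn_integral_words_prod[where c="\<lambda>j. \<integral>\<^sup>+p. ennreal (p j powr \<theta>) \<partial>\<nu>"])

end

section \<open>Lines of heavy boxes in almost every environment\<close>

lemma mass_cong:
  assumes "\<And>w. length w < length i \<Longrightarrow> e w = e' w"
  shows "mass e i = mass e' i"
  unfolding mass_def using assms by (intro prod.cong) auto

text \<open>Bounding an indicator from below by a quadratic in a count is the second moment method without division;
  optimising over \<open>t\<close> recovers the Cauchy-Schwarz form.\<close>

lemma selection_bound: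
  fixes x t :: real
  shows "(if x = 0 then 0 else 1) \<ge> 2 * t * x - t\<^sup>2 * x\<^sup>2"
proof -
  have "0 \<le> (1 - t * x)\<^sup>2" by simp
  then show ?thesis by (auto simp: power2_eq_square algebra_simps)
qed

context splitting_law
begin

lemma indep_prefix_subtree:
  assumes i: "length i = K" "0 < K" and A: "A \<in> sets env" and R: "R \<in> sets env"
    and Rdep: "\<And>e e'. e \<in> space env \<Longrightarrow> e' \<in> space env \<Longrightarrow> (\<And>w. length w < K \<Longrightarrow> e w = e' w) \<Longrightarrow> e \<in> R \<Longrightarrow> e' \<in> R"
  shows "env.prob (R \<inter> {e\<in>space env. subenv i e \<in> A}) = env.prob R * env.prob A"
proof -
  define i' where "i' = Suc (hd i) # tl i"
  have "length i' = K" "i \<noteq> i'" using i by (cases i; auto simp: i'_def)+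
  from indep_prefix_subtrees[OF i(1) this A sets.top R Rdep]
  show ?thesis by (simp add: subenv_space env.prob_space cong: conj_cong)
qed

text \<open>Some heavy box of the block leads into \<open>A\<close>: the number of such boxes has mean \<open>\<mu> * prob A\<close>, and by the
  branching property distinct boxes contribute at most \<open>prob A ^ 2\<close> each to its second moment.\<close>

lemma prob_offspring_lower:
  fixes c t :: real
  assumes F: "finite F" "\<And>i. i \<in> F \<Longrightarrow> length i = K" "0 < K" and A: "A \<in> sets env"
  defines "\<mu> \<equiv> (\<Sum>i\<in>F. env.prob {e\<in>space env. c \<le> mass e i})"
  shows "env.prob {e\<in>space env. \<exists>i\<in>F. c \<le> mass e i \<and> subenv i e \<in> A} \<ge>
    2 * t * \<mu> * env.prob A - t\<^sup>2 * (\<mu> * env.prob A + (card F)\<^sup>2 * (env.prob A)\<^sup>2)"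
proof -
  note A [measurable] and F(1) [simp]
  let ?u = "env.prob A"
  define G where "G i = {e\<in>space env. c \<le> mass e i}" for i
  define H where "H i = {e\<in>space env. c \<le> mass e i \<and> subenv i e \<in> A}" for i
  define D where "D = {e\<in>space env. \<exists>i\<in>F. c \<le> mass e i \<and> subenv i e \<in> A}"
  have [measurable]: "G i \<in> sets env" "H i \<in> sets env" for i
    unfolding G_def H_def by measurable
  have D [measurable]: "D \<in> sets env"
  proof -
    have "D = (\<Union>i\<in>F. H i)" by (auto simp: D_def H_def)
    then show ?thesis by auto
  qed
  have dep: "e' \<in> G i" if "i \<in> F" "e \<in> G i" "e' \<in> space env" "\<And>w. length w < K \<Longrightarrow> e w = e' w" for e e' i
    using mass_cong[of i e e'] that F(2) by (auto simp: G_def)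
  have H1: "env.prob (H i) = env.prob (G i) * ?u" if "i \<in> F" for i
  proof -
    have "env.prob (G i \<inter> {e\<in>space env. subenv i e \<in> A}) = env.prob (G i) * ?u"
      using that dep[OF that] F by (intro indep_prefix_subtree) auto
    also have "G i \<inter> {e\<in>space env. subenv i e \<in> A} = H i" by (auto simp: G_def H_def)
    finally show ?thesis .
  qed
  have H2: "env.prob (H i \<inter> H i') \<le> ?u\<^sup>2" if "i \<in> F" "i' \<in> F" "i \<noteq> i'" for i i'
  proof -
    have "env.prob ((G i \<inter> G i') \<inter> {e\<in>space env. subenv i e \<in> A \<and> subenv i' e \<in> A}) = env.prob (G i \<inter> G i') * ?u * ?u"
      using that dep[OF that(1)] dep[OF that(2)] F by (intro indep_prefix_subtrees) auto
    also have "(G i \<inter> G i') \<inter> {e\<in>space env. subenv i e \<in> A \<and> subenv i' e \<in> A} = H i \<inter> H i'"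
      by (auto simp: G_def H_def)
    also have "env.prob (G i \<inter> G i') * ?u * ?u \<le> 1 * ?u * ?u"
      by (intro mult_right_mono env.prob_le_1) auto
    finally show ?thesis by (simp add: power2_eq_square)
  qed
  have int [simp]: "integrable env (indicator S :: _ \<Rightarrow> real)" if "S \<in> sets env" for S
    using that by (simp add: less_top[symmetric])
  define X :: "_ \<Rightarrow> real" where "X e = (\<Sum>i\<in>F. indicator (H i) e)" for e
  have EX: "(\<integral>e. X e \<partial>env) = \<mu> * ?u"
    unfolding X_def \<mu>_def
    by (subst Bochner_Integration.integral_sum) (auto simp: H1 sum_distrib_right G_def)
  have X2: "(X e)\<^sup>2 = (\<Sum>(i, i')\<in>F \<times> F. indicator (H i \<inter> H i') e)" for e
    unfolding X_def power2_eq_square sum_product sum.cartesian_product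
    by (intro sum.cong) (auto simp: indicator_def)
  have iX2: "integrable env (\<lambda>e. (X e)\<^sup>2)" unfolding X2 by (auto simp: split_beta)
  have iX: "integrable env X" unfolding X_def by auto
  have "(\<integral>e. (X e)\<^sup>2 \<partial>env) = (\<Sum>(i, i')\<in>F \<times> F. env.prob (H i \<inter> H i'))"
    unfolding X2 by (subst Bochner_Integration.integral_sum) (auto simp: split_beta)
  also have "\<dots> \<le> (\<Sum>(i, i')\<in>F \<times> F. (if i = i' then env.prob (H i) else 0) + ?u\<^sup>2)"
    using H2 by (intro sum_mono) auto
  also have "\<dots> = (\<Sum>i\<in>F. env.prob (H i)) + (card F)\<^sup>2 * ?u\<^sup>2"
    by (simp add: sum.distrib split_beta sum.cartesian_product[symmetric, of "\<lambda>i i'. if i = i' then env.prob (H i) else 0", unfolded split_beta] card_cartesian_product power2_eq_square)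
  also have "(\<Sum>i\<in>F. env.prob (H i)) = \<mu> * ?u" by (simp add: H1 \<mu>_def sum_distrib_right G_def)
  finally have EX2: "(\<integral>e. (X e)\<^sup>2 \<partial>env) \<le> \<mu> * ?u + (card F)\<^sup>2 * ?u\<^sup>2" .
  have "2 * t * \<mu> * ?u - t\<^sup>2 * (\<mu> * ?u + (card F)\<^sup>2 * ?u\<^sup>2) \<le> 2 * t * (\<integral>e. X e \<partial>env) - t\<^sup>2 * (\<integral>e. (X e)\<^sup>2 \<partial>env)"
    using mult_left_mono[OF EX2, of "t\<^sup>2"] by (simp add: EX)
  also have "\<dots> = (\<integral>e. 2 * t * X e - t\<^sup>2 * (X e)\<^sup>2 \<partial>env)"
    using iX iX2 by (subst Bochner_Integration.integral_diff) auto
  also have "\<dots> \<le> (\<integral>e. indicator D e \<partial>env)"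
  proof (rule integral_mono)
    fix e assume "e \<in> space env"
    have "X e = 0" if "e \<notin> D"
      using that unfolding X_def by (intro sum.neutral) (auto simp: D_def H_def indicator_def)
    then show "2 * t * X e - t\<^sup>2 * (X e)\<^sup>2 \<le> indicator D e"
      using selection_bound[of t "X e"] by (cases "e \<in> D"; cases "X e = 0"; simp)
  qed (use iX iX2 in auto)
  finally show ?thesis by (simp add: D_def)
qed

text \<open>Environments whose heaviest boxes decay no faster than \<open>exp (- a * k)\<close>, up to a constant that may depend on
  the environment.  Constants \<open>1 / Suc m\<close> suffice and keep the set measurable.\<close>

definition heavy_lines :: "real \<Rightarrow> (nat list \<Rightarrow> nat \<Rightarrow> real) set" where
  "heavy_lines a = {e\<in>space env. \<exists>m::nat. \<forall>k. \<exists>i. length i = k \<and> exp (- a * k) / Suc m \<le> mass e i}"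

lemma heavy_lines_sets [measurable]: "heavy_lines a \<in> sets env"
  unfolding heavy_lines_def by measurable

text \<open>Survival of a supercritical branching process.  With mean \<open>\<mu> > 1\<close>, the second moment bound maps survival
  probabilities at least \<open>u0\<close> to survival probabilities at least \<open>u0\<close>, so the probability of surviving \<open>r\<close> blocks
  stays above \<open>u0\<close> for all \<open>r\<close>.\<close>

lemma prob_heavy_lines_pos:
  assumes a: "0 \<le> a" and F: "finite F" "\<And>i. i \<in> F \<Longrightarrow> length i = K" "0 < K"
    and super: "1 < (\<Sum>i\<in>F. env.prob {e\<in>space env. exp (- a * K) \<le> mass e i})"
  shows "0 < env.prob (heavy_lines a)"
proof -
  define c where "c = exp (- a * K)"
  define \<mu> where "\<mu> = (\<Sum>i\<in>F. env.prob {e\<in>space env. c \<le> mass e i})"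
  have \<mu>: "1 < \<mu>" using super by (simp add: \<mu>_def c_def)
  define C :: real where "C = (card F)\<^sup>2"
  have "F \<noteq> {}" using super by auto
  then have C: "0 < C" using F(1) by (simp add: C_def card_gt_0_iff)
  define A where "A r = ((\<lambda>S. {e\<in>space env. \<exists>i\<in>F. c \<le> mass e i \<and> subenv i e \<in> S}) ^^ r) (space env)" for r
  have A0: "A 0 = space env" by (simp add: A_def)
  have AS: "A (Suc r) = {e\<in>space env. \<exists>i\<in>F. c \<le> mass e i \<and> subenv i e \<in> A r}" for r by (simp add: A_def)
  have Am [measurable]: "A r \<in> sets env" for r
  proof (induction r)
    case (Suc r)
    note Suc [measurable]
    have "A (Suc r) = (\<Union>i\<in>F. {e\<in>space env. c \<le> mass e i \<and> subenv i e \<in> A r})" by (auto simp: AS)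
    also have "\<dots> \<in> sets env" using F(1) by (intro sets.finite_UN) measurable
    finally show ?case .
  qed (simp add: A0)
  \<comment> \<open>The positive fixed point of \<open>u \<mapsto> \<mu>^2 * u / (\<mu> + C * u)\<close>, which is the best bound that
    \<open>prob_offspring_lower\<close> gives; it is attained at \<open>t = \<mu> / (\<mu> + C * u)\<close>.\<close>
  define u0 where "u0 = min 1 ((\<mu>\<^sup>2 - \<mu>) / C)"
  have u0: "0 < u0" "u0 \<le> 1" "C * u0 \<le> \<mu>\<^sup>2 - \<mu>"
  proof -
    have "0 < \<mu>\<^sup>2 - \<mu>" using \<mu> by (simp add: power2_eq_square)
    then show "0 < u0" using C by (simp add: u0_def)
    have "C * u0 \<le> C * ((\<mu>\<^sup>2 - \<mu>) / C)" using C by (intro mult_left_mono) (auto simp: u0_def)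
    then show "C * u0 \<le> \<mu>\<^sup>2 - \<mu>" using C by simp
  qed (simp add: u0_def)
  have lower: "u0 \<le> env.prob (A r)" for r
  proof (induction r)
    case 0 then show ?case using u0 by (simp add: A0 env.prob_space)
  next
    case (Suc r)
    let ?u = "env.prob (A r)"
    have u: "0 < ?u" using Suc u0 by linarith
    define d where "d = \<mu> + C * ?u"
    have d: "0 < d" using \<mu> C u by (auto simp: d_def intro!: add_pos_pos)
    have "C * u0 * ?u \<le> (\<mu>\<^sup>2 - \<mu>) * ?u" using u0 u by (intro mult_right_mono) auto
    moreover have "u0 * \<mu> \<le> ?u * \<mu>" using Suc \<mu> by (intro mult_right_mono) auto
    ultimately have "u0 * d \<le> \<mu>\<^sup>2 * ?u" by (simp add: d_def algebra_simps)
    then have "u0 \<le> \<mu>\<^sup>2 * ?u / d" using d by (simp add: field_simps)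
    also have "\<dots> = 2 * (\<mu> / d) * \<mu> * ?u - (\<mu> / d)\<^sup>2 * (?u * d)"
      using d by (simp add: field_simps power2_eq_square)
    also have "\<dots> = 2 * (\<mu> / d) * \<mu> * ?u - (\<mu> / d)\<^sup>2 * (\<mu> * ?u + (card F)\<^sup>2 * ?u\<^sup>2)"
      by (simp add: d_def C_def algebra_simps power2_eq_square)
    also have "\<dots> \<le> env.prob (A (Suc r))"
      unfolding AS \<mu>_def by (rule prob_offspring_lower[OF F Am])
    finally show ?case .
  qed
  have "A (Suc r) \<subseteq> A r" for r
    by (induction r) (use AS A0 in auto)
  then have "decseq A" by (rule decseq_SucI)
  then have "(\<lambda>r. env.prob (A r)) \<longlonglongrightarrow> env.prob (\<Inter>r. A r)"
    by (intro env.finite_Lim_measure_decseq) auto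
  then have "u0 \<le> env.prob (\<Inter>r. A r)"
    using lower by (intro LIMSEQ_le_const) auto
  moreover have "(\<Inter>r. A r) \<subseteq> heavy_lines a"
  proof
    fix e assume e: "e \<in> (\<Inter>r. A r)"
    then have sp: "e \<in> space env" using A0 by blast
    have path: "\<exists>i. length i = r * K \<and> c ^ r \<le> mass e i" if "e \<in> A r" for r e
      using that
    proof (induction r arbitrary: e)
      case 0 then show ?case by auto
    next
      case (Suc r)
      then obtain i where i: "i \<in> F" "c \<le> mass e i" "subenv i e \<in> A r" by (auto simp: AS)
      with Suc.IH obtain i' where i': "length i' = r * K" "c ^ r \<le> mass (subenv i e) i'" by blast
      have "c ^ Suc r \<le> mass e (i @ i')"
        unfolding mass_append power_Suc using i i' by (intro mult_mono) (auto simp: c_def intro: order_trans[rotated])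
      then show ?case using i i' F(2) by (intro exI[of _ "i @ i'"]) auto
    qed
    obtain m :: nat where m: "exp (a * K) \<le> Suc m"
      using real_arch_simple[of "exp (a * K)"] by (metis le_SucI of_nat_le_iff order_trans order_refl)
    have "\<exists>i. length i = k \<and> exp (- a * k) / Suc m \<le> mass e i" for k
    proof -
      \<comment> \<open>The next multiple of \<open>K\<close> above \<open>k\<close>; masses only increase when passing from a box to its ancestor.\<close>
      define r where "r = Suc (k div K)"
      have "r * K = (k div K) * K + K" by (simp add: r_def)
      then have r: "k \<le> r * K" "r * K \<le> k + K"
        using mod_less_divisor[OF \<open>0 < K\<close>, of k] div_mult_mod_eq[of k K] by linarith+
      obtain i where i: "length i = r * K" "c ^ r \<le> mass e i" using path[of e r] e by blast
      have "mass e i = mass e (take k i) * mass (subenv (take k i) e) (drop k i)"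
        by (simp flip: mass_append)
      also have "\<dots> \<le> mass e (take k i) * 1"
        using sp by (intro mult_left_mono mass_bounds subenv_space)
      finally have "c ^ r \<le> mass e (take k i)" using i by simp
      moreover have "c ^ r = exp (- a * (r * K))"
        by (simp add: c_def exp_of_nat_mult[symmetric] mult.assoc mult.left_commute)
      moreover have "exp (- a * k) / Suc m \<le> exp (- a * k) / exp (a * K)"
        using m by (intro divide_left_mono) auto
      moreover have "exp (- a * k) / exp (a * K) = exp (- a * (k + K))"
        by (simp add: exp_diff[symmetric] algebra_simps)
      moreover have "exp (- a * (k + K)) \<le> exp (- a * (r * K))"
        using r a by (simp add: mult_left_mono flip: of_nat_mult of_nat_add)
      ultimately have "exp (- a * k) / Suc m \<le> mass e (take k i)" by linarith
      then show ?thesis using i r by (intro exI[of _ "take k i"]) auto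
    qed
    then show "e \<in> heavy_lines a" using sp by (auto simp: heavy_lines_def)
  qed
  then have "env.prob (\<Inter>r. A r) \<le> env.prob (heavy_lines a)"
    by (intro env.finite_measure_mono) auto
  ultimately show ?thesis using u0 by linarith
qed

text \<open>A heavy line below a child of positive mass is a heavy line from the root, at the price of a smaller constant;
  this is the inheritance that drives the zero-one law.\<close>

lemma heavy_lines_child:
  assumes e: "e \<in> space env" "0 < e [] j" "subenv [j] e \<in> heavy_lines a"
  shows "e \<in> heavy_lines a"
proof -
  obtain m where m: "\<And>k. \<exists>i. length i = k \<and> exp (- a * k) / Suc m \<le> mass (subenv [j] e) i"
    using e(3) by (auto simp: heavy_lines_def)
  obtain m' :: nat where m': "exp (- a) * Suc m / e [] j \<le> m'" using real_arch_simple by blast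
  have "\<exists>i. length i = k \<and> exp (- a * k) / Suc m' \<le> mass e i" for k
  proof (cases k)
    case 0 then show ?thesis by (intro exI[of _ "[]"]) auto
  next
    case (Suc k')
    obtain i where i: "length i = k'" "exp (- a * k') / Suc m \<le> mass (subenv [j] e) i" using m by blast
    have "exp (- a * k) / Suc m' = exp (- a * k') * (exp (- a) / Suc m')"
      by (simp add: Suc exp_add[symmetric] algebra_simps)
    also have "exp (- a) / Suc m' \<le> e [] j / Suc m"
    proof -
      have "exp (- a) * Suc m \<le> m' * e [] j" using m' e(2) by (simp add: field_simps)
      also have "\<dots> \<le> Suc m' * e [] j" using e(2) by simp
      finally show ?thesis by (simp add: field_simps)
    qed
    finally have "exp (- a * k) / Suc m' \<le> e [] j * (exp (- a * k') / Suc m)"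
      by (simp add: field_simps)
    also have "\<dots> \<le> e [] j * mass (subenv [j] e) i" using i(2) e(2) by (intro mult_left_mono) auto
    finally show ?thesis using i Suc by (intro exI[of _ "j # i"]) (auto simp: mass_Cons)
  qed
  then show ?thesis using e(1) by (auto simp: heavy_lines_def)
qed

text \<open>If there are no heavy lines from the root, there are none from any child of positive mass.  Using one such child
  always, and two independent ones with probability \<open>c > 0\<close>, the failure probability \<open>s\<close> satisfies
  \<open>s \<le> c * s^2 + (1 - c) * s\<close>, which leaves only \<open>s = 0\<close> and \<open>s = 1\<close>.\<close>

lemma prob_heavy_lines_zero_one:
  assumes jj: "j \<noteq> j'" "0 < env.prob {e\<in>space env. 0 < e [] j \<and> 0 < e [] j'}"
    and pos: "0 < env.prob (heavy_lines a)"
  shows "env.prob (heavy_lines a) = 1"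
proof -
  define D where "D = space env - heavy_lines a"
  have [measurable]: "D \<in> sets env" by (simp add: D_def)
  define s where "s = env.prob D"
  have s: "s = 1 - env.prob (heavy_lines a)" unfolding s_def D_def by (rule env.prob_compl) simp
  define R where "R = {e\<in>space env. 0 < e [] j \<and> 0 < e [] j'}"
  have [measurable]: "R \<in> sets env" by (simp add: R_def)
  define c where "c = env.prob R"
  have "env.prob (D \<inter> R) \<le> env.prob (R \<inter> {e\<in>space env. subenv [j] e \<in> D \<and> subenv [j'] e \<in> D})"
    by (rule env.finite_measure_mono)
       (auto simp: D_def R_def subenv_space dest: heavy_lines_child)
  also have "\<dots> = c * s * s"
    unfolding c_def s_def using jj(1)
    by (intro indep_prefix_subtrees[where K=1]) (auto simp: R_def)
  finally have 1: "env.prob (D \<inter> R) \<le> c * s * s" .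
  \<comment> \<open>Split by the first child \<open>l\<close> of positive mass, so that the event depends on the root splitting only.\<close>
  define Q where "Q l = {e\<in>space env. e \<notin> R \<and> 0 < e [] l \<and> (\<forall>l'<l. \<not> 0 < e [] l')}" for l
  have [measurable]: "Q l \<in> sets env" for l unfolding Q_def by measurable
  have disj: "disjoint_family Q"
  proof -
    have "l = l'" if "e \<in> Q l" "e \<in> Q l'" for e l l'
      using that by (cases l l' rule: linorder_cases) (auto simp: Q_def)
    then show ?thesis by (auto simp: disjoint_family_on_def)
  qed
  have cover: "(\<Union>l. Q l) = space env - R"
  proof -
    have "\<exists>l. e \<in> Q l" if e: "e \<in> space env" "e \<notin> R" for e
    proof -
      have "\<exists>l. 0 < e [] l"
      proof (rule ccontr)
        assume "\<not> ?thesis"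
        moreover have "0 \<le> e [] l" for l using e by (simp add: space_env prob_seqs_def)
        ultimately have "e [] = (\<lambda>_. 0)" by (intro ext) (meson antisym not_less)
        moreover have "e [] sums 1" using e by (simp add: space_env prob_seqs_def)
        ultimately have "(\<lambda>_::nat. 0::real) sums 1" by simp
        then show False using sums_unique2[OF sums_zero] by fastforce
      qed
      then obtain l where "0 < e [] l" "\<forall>l'<l. \<not> 0 < e [] l'"
        using exists_least_iff[of "\<lambda>l. 0 < e [] l"] by blast
      then show ?thesis using e by (auto simp: Q_def)
    qed
    then show ?thesis by (auto simp: Q_def)
  qed
  have "(\<lambda>l. env.prob (Q l)) sums env.prob (space env - R)"
    unfolding cover[symmetric] by (rule env.finite_measure_UNION) (auto intro: disj)
  then have Qs: "(\<lambda>l. env.prob (Q l) * s) sums ((1 - c) * s)"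
    by (intro sums_mult2) (simp add: env.prob_compl c_def)
  have Ql: "env.prob (Q l \<inter> {e\<in>space env. subenv [l] e \<in> D}) = env.prob (Q l) * s" for l
    unfolding s_def by (intro indep_prefix_subtree[where K=1]) (auto simp: Q_def R_def)
  have "env.prob (D - R) \<le> env.prob (\<Union>l. Q l \<inter> {e\<in>space env. subenv [l] e \<in> D})"
  proof (rule env.finite_measure_mono)
    show "D - R \<subseteq> (\<Union>l. Q l \<inter> {e\<in>space env. subenv [l] e \<in> D})"
    proof
      fix e assume e: "e \<in> D - R"
      then obtain l where l: "e \<in> Q l" using cover by (auto simp: D_def)
      then have "subenv [l] e \<in> D" using e heavy_lines_child[of e l a] by (auto simp: D_def Q_def subenv_space)
      then show "e \<in> (\<Union>l. Q l \<inter> {e\<in>space env. subenv [l] e \<in> D})" using e l by (auto simp: D_def)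
    qed
  qed auto
  also have "\<dots> \<le> (\<Sum>l. env.prob (Q l \<inter> {e\<in>space env. subenv [l] e \<in> D}))"
    by (rule env.finite_measure_subadditive_countably) (use Qs in \<open>auto simp: Ql sums_iff\<close>)
  also have "\<dots> = (1 - c) * s" using Qs by (simp add: Ql sums_iff)
  finally have 2: "env.prob (D - R) \<le> (1 - c) * s" .
  have "s = env.prob (D \<inter> R) + env.prob (D - R)"
    unfolding s_def by (subst env.finite_measure_Union[symmetric]) (auto intro: arg_cong[where f=env.prob])
  then have "c * s * (1 - s) \<le> 0" using 1 2 by (simp add: algebra_simps)
  moreover have "0 < c" using jj(2) by (simp add: c_def R_def)
  moreover have "0 \<le> s" by (simp add: s_def)
  ultimately show ?thesis
    using pos s env.prob_le_1[of "heavy_lines a"] by (auto simp: mult_le_0_iff)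
qed

end

section \<open>Smoothness of the moment function\<close>

text \<open>Dominated convergence along a real parameter, with a bound only near the limit point.\<close>

lemma tendsto_integral_at:
  fixes s :: "real \<Rightarrow> 'a \<Rightarrow> real"
  assumes [measurable]: "\<And>t. s t \<in> borel_measurable M" "f \<in> borel_measurable M"
    and w: "integrable M w" and \<delta>: "0 < \<delta>"
    and bound: "\<And>x t. x \<in> space M \<Longrightarrow> t \<noteq> \<theta> \<Longrightarrow> \<bar>t - \<theta>\<bar> < \<delta> \<Longrightarrow> \<bar>s t x\<bar> \<le> w x"
    and lim: "\<And>x. x \<in> space M \<Longrightarrow> ((\<lambda>t. s t x) \<longlongrightarrow> f x) (at \<theta>)"
  shows "((\<lambda>t. \<integral>x. s t x \<partial>M) \<longlongrightarrow> (\<integral>x. f x \<partial>M)) (at \<theta>)"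
  unfolding tendsto_at_iff_sequentially comp_def
proof safe
  fix X :: "nat \<Rightarrow> real" assume X: "\<forall>i. X i \<in> UNIV - {\<theta>}" "X \<longlonglongrightarrow> \<theta>"
  have "eventually (\<lambda>i. dist (X i) \<theta> < \<delta>) sequentially" using X(2) \<delta> by (rule tendstoD)
  then obtain N where N: "\<And>i. i \<ge> N \<Longrightarrow> \<bar>X i - \<theta>\<bar> < \<delta>"
    by (auto simp: eventually_sequentially dist_real_def)
  have "(\<lambda>i. \<integral>x. s (X (i + N)) x \<partial>M) \<longlonglongrightarrow> (\<integral>x. f x \<partial>M)"
  proof (rule integral_dominated_convergence[OF _ _ w])
    show "AE x in M. (\<lambda>i. s (X (i + N)) x) \<longlonglongrightarrow> f x"
    proof (rule AE_I2)
      fix x assume "x \<in> space M"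
      then have "(\<lambda>i. s (X i) x) \<longlonglongrightarrow> f x"
        using lim[of x] X unfolding tendsto_at_iff_sequentially comp_def by blast
      then show "(\<lambda>i. s (X (i + N)) x) \<longlonglongrightarrow> f x" by (rule LIMSEQ_ignore_initial_segment)
    qed
    show "AE x in M. norm (s (X (i + N)) x) \<le> w x" for i
      using X N by (intro AE_I2) (auto intro!: bound)
  qed measurable
  then show "(\<lambda>i. \<integral>x. s (X i) x \<partial>M) \<longlonglongrightarrow> (\<integral>x. f x \<partial>M)" by (rule LIMSEQ_offset)
qed

text \<open>The logarithm costs an arbitrarily small power, since \<open>ln y \<le> y\<close> for \<open>y = g powr (- \<delta>)\<close>.\<close>

lemma powr_ln_bound:
  fixes g :: real
  assumes "0 \<le> g" "g \<le> 1" "0 < \<delta>"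
  shows "\<bar>g powr \<theta> * ln g\<bar> \<le> g powr (\<theta> - \<delta>) / \<delta>"
proof (cases "g = 0")
  case False
  with assms have g: "0 < g" by simp
  have "\<delta> * \<bar>ln g\<bar> = ln (g powr (- \<delta>))" using g assms by (simp add: ln_powr)
  also have "\<dots> \<le> g powr (- \<delta>)" using g ln_le_minus_one[of "g powr (- \<delta>)"] by simp
  finally have "\<bar>ln g\<bar> \<le> g powr (- \<delta>) / \<delta>" using assms by (simp add: field_simps)
  then have "g powr \<theta> * \<bar>ln g\<bar> \<le> g powr \<theta> * (g powr (- \<delta>) / \<delta>)" by (intro mult_left_mono) auto
  also have "\<dots> = g powr (\<theta> - \<delta>) / \<delta>" by (simp flip: powr_add)
  finally show ?thesis by (simp add: abs_mult)
qed (use assms in auto)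

lemma DERIV_powr_exponent:
  fixes g :: real
  assumes "0 \<le> g"
  shows "((\<lambda>t. g powr t) has_real_derivative g powr t * ln g) (at t)"
proof (cases "g = 0")
  case False
  with assms show ?thesis by (auto intro!: derivative_eq_intros)
qed auto

text \<open>Moments of a function with values in \<open>[0, 1]\<close>, as functions of the exponent.  The function \<open>l\<close> is of this
  kind, for the product of counting measure and the splitting law.\<close>

locale power_moments =
  fixes M :: "'a measure" and g :: "'a \<Rightarrow> real" and \<theta>\<^sub>0 :: real
  assumes g [measurable]: "g \<in> borel_measurable M"
    and g01: "\<And>x. x \<in> space M \<Longrightarrow> 0 \<le> g x \<and> g x \<le> 1"
    and int: "\<And>\<theta>. \<theta>\<^sub>0 < \<theta> \<Longrightarrow> integrable M (\<lambda>x. g x powr \<theta>)"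
begin

lemma DERIV_moment:
  assumes "\<theta>\<^sub>0 < \<theta>"
  shows "((\<lambda>\<theta>. \<integral>x. g x powr \<theta> \<partial>M) has_real_derivative (\<integral>x. g x powr \<theta> * ln (g x) \<partial>M)) (at \<theta>)"
proof -
  \<comment> \<open>One \<open>\<delta>\<close> is spent on the neighbourhood of \<open>\<theta>\<close>, a second one on the logarithm, and the third keeps the
    dominating exponent above \<open>\<theta>\<^sub>0\<close>.\<close>
  define \<delta> where "\<delta> = (\<theta> - \<theta>\<^sub>0) / 3"
  have \<delta>: "0 < \<delta>" "\<theta>\<^sub>0 < \<theta> - 2 * \<delta>" using assms by (auto simp: \<delta>_def field_simps)
  have "((\<lambda>t. \<integral>x. (g x powr t - g x powr \<theta>) / (t - \<theta>) \<partial>M) \<longlongrightarrow> (\<integral>x. g x powr \<theta> * ln (g x) \<partial>M)) (at \<theta>)"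
  proof (rule tendsto_integral_at[OF _ _ _ \<delta>(1)])
    show "integrable M (\<lambda>x. g x powr (\<theta> - 2 * \<delta>) / \<delta>)" using int[OF \<delta>(2)] by simp
    show "((\<lambda>t. (g x powr t - g x powr \<theta>) / (t - \<theta>)) \<longlongrightarrow> g x powr \<theta> * ln (g x)) (at \<theta>)" if "x \<in> space M" for x
      using DERIV_powr_exponent[of "g x" \<theta>] g01[OF that] by (simp add: has_field_derivative_iff)
    fix x t assume x: "x \<in> space M" and t: "t \<noteq> \<theta>" "\<bar>t - \<theta>\<bar> < \<delta>"
    have D: "((\<lambda>t. g x powr t) has_real_derivative g x powr t * ln (g x)) (at t)" for t
      using g01[OF x] by (intro DERIV_powr_exponent) auto
    obtain \<xi> where \<xi>: "\<bar>\<xi> - \<theta>\<bar> < \<delta>" "g x powr t - g x powr \<theta> = (t - \<theta>) * (g x powr \<xi> * ln (g x))"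
    proof (cases "t < \<theta>")
      case True
      with MVT2[OF True D] obtain z where "t < z" "z < \<theta>" "g x powr \<theta> - g x powr t = (\<theta> - t) * (g x powr z * ln (g x))" by blast
      then show ?thesis using t by (intro that[of z]) (auto simp: algebra_simps)
    next
      case False
      with t have "\<theta> < t" by simp
      with MVT2[OF this D] obtain z where "\<theta> < z" "z < t" "g x powr t - g x powr \<theta> = (t - \<theta>) * (g x powr z * ln (g x))" by blast
      then show ?thesis using t by (intro that[of z]) auto
    qed
    have "\<bar>(g x powr t - g x powr \<theta>) / (t - \<theta>)\<bar> = \<bar>g x powr \<xi> * ln (g x)\<bar>"
      using \<xi>(2) t by simp
    also have "\<dots> \<le> g x powr (\<xi> - \<delta>) / \<delta>" using g01[OF x] \<delta> by (intro powr_ln_bound) auto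
    also have "\<dots> \<le> g x powr (\<theta> - 2 * \<delta>) / \<delta>"
      using g01[OF x] \<delta> \<xi>(1) by (intro divide_right_mono powr_mono') auto
    finally show "\<bar>(g x powr t - g x powr \<theta>) / (t - \<theta>)\<bar> \<le> g x powr (\<theta> - 2 * \<delta>) / \<delta>" .
  qed measurable
  moreover have "eventually (\<lambda>t. (\<integral>x. (g x powr t - g x powr \<theta>) / (t - \<theta>) \<partial>M) =
      ((\<integral>x. g x powr t \<partial>M) - (\<integral>x. g x powr \<theta> \<partial>M)) / (t - \<theta>)) (at \<theta>)"
  proof -
    have "eventually (\<lambda>t. \<theta>\<^sub>0 < t) (at \<theta>)"
      using assms order_tendstoD(1)[OF tendsto_ident_at] by blast
    then show ?thesis
      by eventually_elim (simp add: Bochner_Integration.integral_diff int assms)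
  qed
  ultimately show ?thesis
    unfolding has_field_derivative_iff by (rule Lim_transform_eventually)
qed

lemma isCont_moment_deriv:
  assumes "\<theta>\<^sub>0 < \<theta>"
  shows "isCont (\<lambda>\<theta>. \<integral>x. g x powr \<theta> * ln (g x) \<partial>M) \<theta>"
proof -
  define \<delta> where "\<delta> = (\<theta> - \<theta>\<^sub>0) / 3"
  have \<delta>: "0 < \<delta>" "\<theta>\<^sub>0 < \<theta> - 2 * \<delta>" using assms by (auto simp: \<delta>_def field_simps)
  show ?thesis
    unfolding isCont_def
  proof (rule tendsto_integral_at[OF _ _ _ \<delta>(1)])
    show "integrable M (\<lambda>x. g x powr (\<theta> - 2 * \<delta>) / \<delta>)" using int[OF \<delta>(2)] by simp
    show "((\<lambda>t. g x powr t * ln (g x)) \<longlongrightarrow> g x powr \<theta> * ln (g x)) (at \<theta>)" if "x \<in> space M" for x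
      using DERIV_isCont[OF DERIV_powr_exponent[of "g x" \<theta>]] g01[OF that] by (auto simp: isCont_def intro!: tendsto_mult)
    fix x t assume x: "x \<in> space M" and t: "t \<noteq> \<theta>" "\<bar>t - \<theta>\<bar> < \<delta>"
    have "\<bar>g x powr t * ln (g x)\<bar> \<le> g x powr (t - \<delta>) / \<delta>" using g01[OF x] \<delta> by (intro powr_ln_bound) auto
    also have "\<dots> \<le> g x powr (\<theta> - 2 * \<delta>) / \<delta>"
      using g01[OF x] \<delta> t by (intro divide_right_mono powr_mono') auto
    finally show "\<bar>g x powr t * ln (g x)\<bar> \<le> g x powr (\<theta> - 2 * \<delta>) / \<delta>" .
  qed measurable
qed

end

context splitting_law
begin

abbreviation atom :: "nat \<times> (nat \<Rightarrow> real) \<Rightarrow> real" where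
  "atom x \<equiv> snd x (fst x)"

abbreviation atoms :: "(nat \<times> (nat \<Rightarrow> real)) measure" where
  "atoms \<equiv> count_space UNIV \<Otimes>\<^sub>M \<nu>"

lemma measurable_atoms [measurable]: "atom \<in> borel_measurable atoms"
  by (rule measurable_pair_measure_countable1) auto

lemma ell_eq_atoms: "ell \<nu> \<theta> = (\<integral>\<^sup>+x. ennreal (atom x powr \<theta>) \<partial>atoms)"
  by (subst nu.nn_integral_fst[symmetric])
     (auto simp: ell_eq_suminf nn_integral_count_space_nat)

lemma atoms_bounds: "x \<in> space atoms \<Longrightarrow> 0 \<le> atom x \<and> atom x \<le> 1"
  by (auto simp: space_pair_measure space_law atom_bounds)

lemma ell_antimono: "\<theta> \<le> \<theta>' \<Longrightarrow> ell \<nu> \<theta>' \<le> ell \<nu> \<theta>"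
  unfolding ell_eq_atoms by (intro nn_integral_mono ennreal_leI powr_mono') (use atoms_bounds in blast)+

lemma ell_1: "ell \<nu> 1 = 1"
proof -
  have "(\<Sum>j. ennreal (p j powr 1)) = 1" if "p \<in> space \<nu>" for p
  proof -
    have p: "\<And>j. 0 \<le> p j" "p sums 1" using that by (auto simp: space_law prob_seqs_def)
    have "(\<Sum>j. ennreal (p j powr 1)) = (\<Sum>j. ennreal (p j))" using p(1) by simp
    also have "\<dots> = ennreal 1" using p by (rule suminf_ennreal_eq)
    finally show ?thesis by simp
  qed
  then have "ell \<nu> 1 = (\<integral>\<^sup>+p. 1 \<partial>\<nu>)"
    unfolding ell_def by (rule nn_integral_cong)
  then show ?thesis by (simp add: nu.emeasure_space_1)
qed

lemma theta_low_bounds: "0 \<le> theta_low \<nu>" "theta_low \<nu> \<le> 1"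
proof -
  have 1: "1 \<in> {\<theta>. 0 < \<theta> \<and> ell \<nu> \<theta> < \<infinity>}" by (simp add: ell_1)
  show "0 \<le> theta_low \<nu>"
    unfolding theta_low_def by (rule cInf_greatest) (use 1 in blast, auto)
  show "theta_low \<nu> \<le> 1"
    unfolding theta_low_def by (rule cInf_lower[OF 1]) (auto intro: bdd_belowI[of _ 0])
qed

lemma ell_finite: assumes "theta_low \<nu> < \<theta>" shows "ell \<nu> \<theta> < \<infinity>"
proof -
  have "\<exists>\<theta>'\<in>{\<theta>. 0 < \<theta> \<and> ell \<nu> \<theta> < \<infinity>}. \<theta>' < \<theta>"
    using assms unfolding theta_low_def
    by (subst (asm) cInf_less_iff) (auto simp: ell_1 intro!: exI[of _ 1] bdd_belowI[of _ 0])
  then show ?thesis using ell_antimono[of _ \<theta>] by (metis (mono_tags, lifting) less_imp_le le_less_trans mem_Collect_eq)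
qed

lemma ennreal_ellr: "theta_low \<nu> < \<theta> \<Longrightarrow> ennreal (ellr \<nu> \<theta>) = ell \<nu> \<theta>"
  using ell_finite[of \<theta>] by (simp add: ellr_def ennreal_enn2real)

lemma integrable_atoms: "ell \<nu> \<theta> < \<infinity> \<Longrightarrow> integrable atoms (\<lambda>x. atom x powr \<theta>)"
  by (rule integrableI_nonneg) (auto simp: ell_eq_atoms)

sublocale pm: power_moments atoms atom "theta_low \<nu>"
  using atoms_bounds by unfold_locales (auto intro: integrable_atoms[OF ell_finite])

lemma ellr_eq_integral: "ellr \<nu> \<theta> = (\<integral>x. atom x powr \<theta> \<partial>atoms)"
  unfolding ellr_def ell_eq_atoms by (rule integral_eq_nn_integral[symmetric]) auto

definition ell_deriv :: "real \<Rightarrow> real" where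
  "ell_deriv \<theta> = (\<integral>x. atom x powr \<theta> * ln (atom x) \<partial>atoms)"

lemma DERIV_ellr: "theta_low \<nu> < \<theta> \<Longrightarrow> (ellr \<nu> has_real_derivative ell_deriv \<theta>) (at \<theta>)"
  using pm.DERIV_moment[of \<theta>] by (simp add: ell_deriv_def ellr_eq_integral[abs_def])

lemma deriv_ellr: "theta_low \<nu> < \<theta> \<Longrightarrow> deriv (ellr \<nu>) \<theta> = ell_deriv \<theta>"
  by (rule DERIV_imp_deriv[OF DERIV_ellr])

lemma isCont_ell_deriv: "theta_low \<nu> < \<theta> \<Longrightarrow> isCont ell_deriv \<theta>"
  using pm.isCont_moment_deriv[of \<theta>] by (simp add: ell_deriv_def[abs_def])

lemma ellr_pos: assumes "theta_low \<nu> < \<theta>" shows "0 < ellr \<nu> \<theta>"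
proof -
  have "ell \<nu> \<theta> \<noteq> 0"
  proof
    assume "ell \<nu> \<theta> = 0"
    then have "AE p in \<nu>. (\<Sum>j. ennreal (p j powr \<theta>)) = 0"
      unfolding ell_def by (subst (asm) nn_integral_0_iff_AE) auto
    then have "AE p in \<nu>. False"
    proof (rule AE_mp, intro AE_I2 impI)
      fix p assume p: "p \<in> space \<nu>" "(\<Sum>j. ennreal (p j powr \<theta>)) = 0"
      have "p j = 0" for j
        using p(2) by (subst (asm) suminf_eq_zero_iff) auto
      then have "p = (\<lambda>_. 0)" by auto
      moreover have "p sums 1" using p(1) by (simp add: space_law prob_seqs_def)
      ultimately show False using sums_unique2[OF sums_zero] by fastforce
    qed
    then show False using nu.AE_False by simp
  qed
  then have "ennreal (ellr \<nu> \<theta>) \<noteq> 0" using ennreal_ellr[OF assms] by simp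
  then show ?thesis by (simp add: ennreal_eq_0_iff)
qed

lemma ellr_le_1: "1 < \<theta> \<Longrightarrow> ellr \<nu> \<theta> \<le> 1"
  using ell_antimono[of 1 \<theta>] enn2real_mono[of "ell \<nu> \<theta>" 1] unfolding ellr_def ell_1 by auto

lemma integrable_ell_deriv:
  assumes "theta_low \<nu> < \<theta>"
  shows "integrable atoms (\<lambda>x. atom x powr \<theta> * ln (atom x))"
proof (rule Bochner_Integration.integrable_bound)
  define \<delta> where "\<delta> = (\<theta> - theta_low \<nu>) / 2"
  have \<delta>: "0 < \<delta>" "theta_low \<nu> < \<theta> - \<delta>" using assms by (auto simp: \<delta>_def field_simps)
  show "integrable atoms (\<lambda>x. atom x powr (\<theta> - \<delta>) / \<delta>)"
    using integrable_atoms[OF ell_finite[OF \<delta>(2)]] by simp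
  show "AE x in atoms. norm (atom x powr \<theta> * ln (atom x)) \<le> norm (atom x powr (\<theta> - \<delta>) / \<delta>)"
  proof (rule AE_I2)
    fix x assume "x \<in> space atoms"
    then show "norm (atom x powr \<theta> * ln (atom x)) \<le> norm (atom x powr (\<theta> - \<delta>) / \<delta>)"
      using powr_ln_bound[of "atom x" \<delta> \<theta>] atoms_bounds[of x] \<delta> by auto
  qed
qed measurable

text \<open>The integrand vanishes only at atoms \<open>0\<close> and \<open>1\<close>, and a law without other atoms is geometric with ratio \<open>1\<close>.\<close>

lemma ell_deriv_neg:
  assumes ng: "\<not> geometric_law \<nu>" and \<theta>: "theta_low \<nu> < \<theta>"
  shows "ell_deriv \<theta> < 0"
proof -
  let ?f = "\<lambda>x. - (atom x powr \<theta> * ln (atom x))"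
  have int: "integrable atoms ?f" using integrable_ell_deriv[OF \<theta>] by simp
  have nonneg: "0 \<le> ?f x" if "x \<in> space atoms" for x
    using atoms_bounds[OF that] by (cases "atom x = 0") (auto simp: mult_le_0_iff)
  have I: "(\<integral>x. ?f x \<partial>atoms) = - ell_deriv \<theta>" unfolding ell_deriv_def by simp
  have "(\<integral>x. ?f x \<partial>atoms) \<noteq> 0"
  proof
    assume "(\<integral>x. ?f x \<partial>atoms) = 0"
    then have "AE x in atoms. ?f x = 0"
      using integral_nonneg_eq_0_iff_AE[OF int] nonneg by auto
    then have "AE x in atoms. atom x = 0 \<or> atom x = 1"
    proof (rule AE_mp, intro AE_I2 impI)
      fix x assume "x \<in> space atoms" "?f x = 0"
      then show "atom x = 0 \<or> atom x = 1"
        using atoms_bounds[of x] by (cases "atom x = 0") auto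
    qed
    then have "AE j in count_space UNIV. AE p in \<nu>. p j = 0 \<or> p j = 1"
      using pair_sigma_finite.AE_pair[of "count_space UNIV" \<nu> "\<lambda>x. atom x = 0 \<or> atom x = 1"]
      by (simp add: pair_sigma_finite_def sigma_finite_measure_count_space nu.sigma_finite_measure_axioms)
    then have "AE p in \<nu>. \<forall>j. p j = 0 \<or> p j = 1"
      by (simp add: AE_count_space AE_all_countable)
    then have "AE p in \<nu>. \<forall>j. 0 < p j \<longrightarrow> (\<exists>n::nat. p j = 1 ^ n)"
      by eventually_elim (metis less_irrefl power_one)
    then show False using ng unfolding geometric_law_def by (auto dest: spec[of _ 1])
  qed
  moreover have "0 \<le> (\<integral>x. ?f x \<partial>atoms)" using nonneg by (intro integral_nonneg_AE AE_I2)
  ultimately show ?thesis using I by linarith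
qed

end

section \<open>The critical exponent\<close>

context splitting_law
begin

text \<open>Otherwise almost every splitting has a single atom, necessarily of mass \<open>1\<close>, and the law is geometric.\<close>

lemma two_atoms:
  assumes ng: "\<not> geometric_law \<nu>"
  obtains j j' where "j \<noteq> j'" "0 < env.prob {e\<in>space env. 0 < e [] j \<and> 0 < e [] j'}"
proof -
  have "\<exists>j j'. j \<noteq> j' \<and> \<not> (AE p in \<nu>. \<not> (0 < p j \<and> 0 < p j'))"
  proof (rule ccontr)
    assume "\<not> ?thesis"
    then have "AE p in \<nu>. \<forall>j j'. j \<noteq> j' \<longrightarrow> \<not> (0 < p j \<and> 0 < p j')"
      by (auto simp: AE_all_countable)
    then have "AE p in \<nu>. \<forall>j. 0 < p j \<longrightarrow> (\<exists>n::nat. p j = 1 ^ n)"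
    proof (rule AE_mp, intro AE_I2 impI allI)
      fix p j assume p: "p \<in> space \<nu>" "\<forall>j j'. j \<noteq> j' \<longrightarrow> \<not> (0 < p j \<and> 0 < p j')" "0 < p j"
      have "p j' = 0" if "j' \<noteq> j" for j'
        using p that atom_bounds(1)[of p j'] by (force simp: space_law)
      then have "p sums p j" using sums_finite[of "{j}" p] by auto
      moreover have "p sums 1" using p(1) by (simp add: space_law prob_seqs_def)
      ultimately have "p j = 1" by (rule sums_unique2)
      then show "\<exists>n::nat. p j = 1 ^ n" by simp
    qed
    then show False using ng unfolding geometric_law_def by (auto dest: spec[of _ 1])
  qed
  then obtain j j' where jj: "j \<noteq> j'" "\<not> (AE p in \<nu>. \<not> (0 < p j \<and> 0 < p j'))" by blast
  have "emeasure \<nu> {p\<in>space \<nu>. 0 < p j \<and> 0 < p j'} \<noteq> 0"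
    using jj(2) by (subst (asm) AE_iff_measurable[OF _ refl]) auto
  moreover have "emeasure env ((\<lambda>e. e []) -` {p\<in>space \<nu>. 0 < p j \<and> 0 < p j'} \<inter> space env) = emeasure \<nu> {p\<in>space \<nu>. 0 < p j \<and> 0 < p j'}"
    by (subst (2) distr_env_component[of "[]", symmetric]) (auto simp: emeasure_distr)
  moreover have "(\<lambda>e. e []) -` {p\<in>space \<nu>. 0 < p j \<and> 0 < p j'} \<inter> space env = {e\<in>space env. 0 < e [] j \<and> 0 < e [] j'}"
    by (auto simp: space_env space_law)
  ultimately have "emeasure env {e\<in>space env. 0 < e [] j \<and> 0 < e [] j'} \<noteq> 0" by simp
  then have "0 < env.prob {e\<in>space env. 0 < e [] j \<and> 0 < e [] j'}"
    by (auto simp: env.emeasure_eq_measure zero_less_measure_iff)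
  with jj(1) show thesis by (rule that)
qed

lemma phi_eq: "theta_low \<nu> < \<theta> \<Longrightarrow> phi \<nu> \<theta> = ln (ellr \<nu> \<theta>) + \<theta> * mm \<nu> \<theta>"
  by (simp add: phi_def mm_def)

lemma mm_eq: "theta_low \<nu> < \<theta> \<Longrightarrow> mm \<nu> \<theta> = - ell_deriv \<theta> / ellr \<nu> \<theta>"
  by (simp add: mm_def deriv_ellr)

lemma isCont_mm: assumes "theta_low \<nu> < \<theta>" shows "isCont (mm \<nu>) \<theta>"
proof -
  have "isCont (\<lambda>\<theta>. - ell_deriv \<theta> / ellr \<nu> \<theta>) \<theta>"
    using ellr_pos[OF assms] isCont_ell_deriv[OF assms] DERIV_isCont[OF DERIV_ellr[OF assms]]
    by (intro continuous_intros) auto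
  moreover have "eventually (\<lambda>t. - ell_deriv t / ellr \<nu> t = mm \<nu> t) (nhds \<theta>)"
    using eventually_nhds_in_open[of "{theta_low \<nu><..}" \<theta>] assms
    by (auto elim!: eventually_mono simp: mm_eq)
  ultimately show ?thesis by (subst isCont_cong[symmetric])
qed

lemma isCont_phi: assumes "theta_low \<nu> < \<theta>" shows "isCont (phi \<nu>) \<theta>"
proof -
  have "isCont (\<lambda>\<theta>. ln (ellr \<nu> \<theta>) + \<theta> * mm \<nu> \<theta>) \<theta>"
    using ellr_pos[OF assms] isCont_mm[OF assms] DERIV_isCont[OF DERIV_ellr[OF assms]]
    by (intro continuous_intros) auto
  moreover have "eventually (\<lambda>t. ln (ellr \<nu> t) + t * mm \<nu> t = phi \<nu> t) (nhds \<theta>)"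
    using eventually_nhds_in_open[of "{theta_low \<nu><..}" \<theta>] assms
    by (auto elim!: eventually_mono simp: phi_eq)
  ultimately show ?thesis by (subst isCont_cong[symmetric])
qed

lemma mm_pos: "\<not> geometric_law \<nu> \<Longrightarrow> theta_low \<nu> < \<theta> \<Longrightarrow> 0 < mm \<nu> \<theta>"
  using ell_deriv_neg ellr_pos by (simp add: mm_eq divide_neg_pos)

lemma ell_deriv_mono:
  assumes "theta_low \<nu> < \<theta>" "\<theta> \<le> \<theta>'"
  shows "ell_deriv \<theta> \<le> ell_deriv \<theta>'"
  unfolding ell_deriv_def
proof (rule integral_mono)
  fix x assume x: "x \<in> space atoms"
  have "atom x powr \<theta>' \<le> atom x powr \<theta>" using atoms_bounds[OF x] assms by (intro powr_mono') auto
  moreover have "ln (atom x) \<le> 0" using atoms_bounds[OF x] by (cases "atom x = 0") auto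
  ultimately show "atom x powr \<theta> * ln (atom x) \<le> atom x powr \<theta>' * ln (atom x)" by (rule mult_right_mono_neg)
qed (use assms in \<open>auto intro!: integrable_ell_deriv\<close>)

text \<open>Continuity from the right at \<open>1\<close>, which must be shown separately because \<open>theta_low \<nu>\<close> can be equal to \<open>1\<close>.\<close>

lemma ellr_limit_1: "(\<lambda>n. ellr \<nu> (1 + 1 / Suc n)) \<longlonglongrightarrow> 1"
proof -
  have "(\<lambda>n. \<integral>x. atom x powr (1 + 1 / Suc n) \<partial>atoms) \<longlonglongrightarrow> (\<integral>x. atom x powr 1 \<partial>atoms)"
  proof (rule integral_dominated_convergence)
    show "integrable atoms (\<lambda>x. atom x powr 1)"
      by (rule integrable_atoms) (simp add: ell_1)
    have e: "(\<lambda>n. 1 + 1 / real (Suc n)) \<longlonglongrightarrow> 1"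
      using tendsto_add[OF tendsto_const LIMSEQ_inverse_real_of_nat, of 1] by (simp add: inverse_eq_divide)
    show "AE x in atoms. (\<lambda>n. atom x powr (1 + 1 / Suc n)) \<longlonglongrightarrow> atom x powr 1"
    proof (rule AE_I2)
      fix x :: "nat \<times> (nat \<Rightarrow> real)" assume x: "x \<in> space atoms"
      have "isCont (\<lambda>t. atom x powr t) 1"
        using DERIV_isCont[OF DERIV_powr_exponent] atoms_bounds[OF x] by blast
      from isCont_tendsto_compose[OF this e]
      show "(\<lambda>n. atom x powr (1 + 1 / Suc n)) \<longlonglongrightarrow> atom x powr 1" .
    qed
    show "AE x in atoms. norm (atom x powr (1 + 1 / Suc n)) \<le> atom x powr 1" for n
    proof (rule AE_I2)
      fix x :: "nat \<times> (nat \<Rightarrow> real)" assume x: "x \<in> space atoms"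
      have "atom x powr (1 + 1 / Suc n) \<le> atom x powr 1"
        using atoms_bounds[OF x] by (intro powr_mono') auto
      then show "norm (atom x powr (1 + 1 / Suc n)) \<le> atom x powr 1" by simp
    qed
  qed measurable
  then show ?thesis by (simp only: ellr_eq_integral[symmetric]) (simp add: ellr_def[of _ 1] ell_1)
qed

text \<open>Near \<open>1\<close> the term \<open>ln l(\<theta>)\<close> tends to \<open>0\<close>, while \<open>\<theta> * mm \<nu> \<theta>\<close> stays above the positive constant
  \<open>- ell_deriv 2\<close> because \<open>ell_deriv\<close> is increasing and \<open>l \<le> 1\<close>.\<close>

lemma phi_pos_near_1:
  assumes ng: "\<not> geometric_law \<nu>"
  obtains \<theta> where "1 < \<theta>" "0 < phi \<nu> \<theta>"
proof -
  define c where "c = - ell_deriv 2"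
  have low: "theta_low \<nu> < \<theta>" if "1 < \<theta>" for \<theta> using that theta_low_bounds by simp
  have c: "0 < c" using ell_deriv_neg[OF ng low, of 2] by (simp add: c_def)
  have "(\<lambda>n. ln (ellr \<nu> (1 + 1 / Suc n))) \<longlonglongrightarrow> ln 1" by (rule tendsto_ln[OF ellr_limit_1]) simp
  then have "eventually (\<lambda>n. - c < ln (ellr \<nu> (1 + 1 / Suc n))) sequentially"
    using c by (intro order_tendstoD(1)) auto
  then obtain n where n: "- c < ln (ellr \<nu> (1 + 1 / Suc n))"
    by (auto simp: eventually_sequentially)
  define \<theta> where "\<theta> = 1 + 1 / real (Suc n)"
  have \<theta>: "1 < \<theta>" "\<theta> \<le> 2" by (auto simp: \<theta>_def)
  have l: "0 < ellr \<nu> \<theta>" "ellr \<nu> \<theta> \<le> 1" using ellr_pos[OF low] ellr_le_1 \<theta> by auto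
  have "c \<le> - ell_deriv \<theta>" using ell_deriv_mono[OF low \<theta>(2)] \<theta> by (simp add: c_def)
  also have "\<dots> \<le> - ell_deriv \<theta> / ellr \<nu> \<theta>"
    using l ell_deriv_neg[OF ng low[OF \<theta>(1)]] by (simp add: field_simps mult_le_cancel_left2)
  also have "\<dots> = mm \<nu> \<theta>" by (simp add: mm_eq low \<theta>)
  also have "\<dots> \<le> \<theta> * mm \<nu> \<theta>" using \<theta> mm_pos[OF ng low[OF \<theta>(1)]] by simp
  finally have "c \<le> \<theta> * mm \<nu> \<theta>" .
  moreover have "- c < ln (ellr \<nu> \<theta>)" unfolding \<theta>_def by (rule n)
  ultimately have "0 < phi \<nu> \<theta>" by (simp add: phi_eq low \<theta>)
  with \<theta> show thesis by (intro that) auto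
qed

text \<open>A continuous function vanishes at the supremum of the set where it is positive, unless that set is unbounded;
  \<open>phi \<nu> T = 0\<close> is the stated formula for \<open>l(T)\<close>.  Points with \<open>phi \<nu> \<theta> > 0\<close> accumulate at \<open>T\<close>, and
  \<open>mm \<nu>\<close> is continuous there.\<close>

lemma critical_exponent:
  assumes ng: "\<not> geometric_law \<nu>" and fin: "theta_up \<nu> \<le> ereal b"
  obtains T where "theta_up \<nu> = ereal T" "1 < T" "0 < mm_lim \<nu>" "mm_lim \<nu> = mm \<nu> T"
    "ellr \<nu> T = exp (- T * mm_lim \<nu>)"
    "\<And>\<epsilon>. 0 < \<epsilon> \<Longrightarrow> \<exists>\<theta>. theta_low \<nu> < \<theta> \<and> 0 < phi \<nu> \<theta> \<and> mm \<nu> \<theta> < mm_lim \<nu> + \<epsilon>"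
proof -
  define S where "S = {\<theta>. theta_low \<nu> < \<theta> \<and> phi \<nu> \<theta> > 0}"
  have upS: "theta_up \<nu> = Sup (ereal ` S)" by (simp add: theta_up_def S_def)
  obtain \<theta>1 where \<theta>1: "1 < \<theta>1" "0 < phi \<nu> \<theta>1" using phi_pos_near_1[OF ng] by blast
  have \<theta>1S: "\<theta>1 \<in> S" using \<theta>1 theta_low_bounds by (simp add: S_def)
  have up1: "ereal \<theta>1 \<le> theta_up \<nu>" unfolding upS using \<theta>1S by (intro Sup_upper) auto
  define T where "T = real_of_ereal (theta_up \<nu>)"
  have T: "theta_up \<nu> = ereal T"
    using up1 fin unfolding T_def by (cases "theta_up \<nu>") auto
  have T1: "1 < T" using up1 \<theta>1 T by simp
  then have low: "theta_low \<nu> < T" using theta_low_bounds by simp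
  have above: "phi \<nu> t \<le> 0" if "T < t" for t
  proof (rule ccontr)
    assume "\<not> ?thesis"
    then have "t \<in> S" using that low by (simp add: S_def)
    then have "ereal t \<le> theta_up \<nu>" unfolding upS by (intro Sup_upper) auto
    then show False using that T by simp
  qed
  have below: "\<exists>t\<in>S. x < t \<and> t \<le> T" if "x < T" for x
  proof -
    have "ereal x < Sup (ereal ` S)" using that T upS by simp
    then obtain t where t: "t \<in> S" "x < t" by (auto simp: less_Sup_iff)
    moreover have "ereal t \<le> theta_up \<nu>" unfolding upS using t by (intro Sup_upper) auto
    ultimately show ?thesis using T by auto
  qed
  have cphi: "(phi \<nu> \<longlongrightarrow> phi \<nu> T) (at T)" using isCont_phi[OF low] by (simp add: isCont_def)
  have phiT: "phi \<nu> T = 0"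
  proof (rule ccontr)
    assume "phi \<nu> T \<noteq> 0"
    then consider "0 < phi \<nu> T" | "phi \<nu> T < 0" by linarith
    then show False
    proof cases
      case 1
      then have "eventually (\<lambda>t. 0 < phi \<nu> t) (at T)" using order_tendstoD(1)[OF cphi] by blast
      then obtain d where d: "0 < d" "\<And>t. t \<noteq> T \<Longrightarrow> dist t T < d \<Longrightarrow> 0 < phi \<nu> t"
        by (auto simp: eventually_at)
      then have "0 < phi \<nu> (T + d / 2)" by (simp add: dist_real_def)
      then show False using above[of "T + d / 2"] d by simp
    next
      case 2
      then have "eventually (\<lambda>t. phi \<nu> t < 0) (at T)" using order_tendstoD(2)[OF cphi] by blast
      then obtain d where d: "0 < d" "\<And>t. t \<noteq> T \<Longrightarrow> dist t T < d \<Longrightarrow> phi \<nu> t < 0"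
        by (auto simp: eventually_at)
      obtain t where t: "t \<in> S" "T - d < t" "t \<le> T" using below[of "T - d"] d by auto
      then have "phi \<nu> t < 0" using d(2)[of t] 2 by (cases "t = T") (auto simp: dist_real_def)
      then show False using t by (simp add: S_def)
    qed
  qed
  have "((\<lambda>\<theta>. mm \<nu> (real_of_ereal \<theta>)) \<longlongrightarrow> mm \<nu> T) (at_left (ereal T))"
    by (rule isCont_tendsto_compose[OF isCont_mm[OF low]])
       (rule lim_real_of_ereal, rule tendsto_ident_at)
  moreover have "at_left (ereal T) \<noteq> bot"
    by (simp add: at_left_ereal filtermap_bot_iff trivial_limit_at_left_real)
  ultimately have lim: "mm_lim \<nu> = mm \<nu> T"
    unfolding mm_lim_def T by (rule tendsto_Lim[rotated])
  have "ln (ellr \<nu> T) = - T * mm \<nu> T" using phiT by (simp add: phi_eq low)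
  then have eT: "ellr \<nu> T = exp (- T * mm_lim \<nu>)" using ellr_pos[OF low] lim by (metis exp_ln)
  have "\<exists>\<theta>. theta_low \<nu> < \<theta> \<and> 0 < phi \<nu> \<theta> \<and> mm \<nu> \<theta> < mm_lim \<nu> + \<epsilon>" if "0 < \<epsilon>" for \<epsilon>
  proof -
    have "eventually (\<lambda>t. mm \<nu> t < mm_lim \<nu> + \<epsilon>) (at T)"
      using isCont_mm[OF low] that lim by (auto simp: isCont_def intro: order_tendstoD(2))
    then obtain d where d: "0 < d" "\<And>t. t \<noteq> T \<Longrightarrow> dist t T < d \<Longrightarrow> mm \<nu> t < mm_lim \<nu> + \<epsilon>"
      by (auto simp: eventually_at)
    obtain t where t: "t \<in> S" "T - d < t" "t \<le> T" using below[of "T - d"] d by auto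
    then have "mm \<nu> t < mm_lim \<nu> + \<epsilon>" using d(2)[of t] lim that by (cases "t = T") (auto simp: dist_real_def)
    then show ?thesis using t by (auto simp: S_def)
  qed
  with T T1 mm_pos[OF ng low] lim eT show thesis by (intro that) auto
qed

end

section \<open>A supercritical block of generations\<close>

text \<open>The pointwise form of two Chernoff bounds: a mass \<open>x\<close> below \<open>exp (- a)\<close> is paid for by a smaller exponent, a
  mass above \<open>exp (- b)\<close> by a larger one, and in between \<open>x powr \<theta>\<close> is at most \<open>exp (- b * \<theta>)\<close>.\<close>

lemma powr_split_bound:
  fixes x :: real
  assumes x: "0 \<le> x" and s: "0 < s" and \<theta>: "0 < \<theta>"
  shows "x powr \<theta> \<le> exp (- b * \<theta>) * (if exp (- a) \<le> x then 1 else 0) + exp (- a * s) * x powr (\<theta> - s) + exp (b * s) * x powr (\<theta> + s)"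
proof (cases "x = 0")
  case False
  define y where "y = ln x"
  have xy: "x = exp y" using x False by (simp add: y_def)
  have nn: "0 \<le> exp (- a * s) * x powr (\<theta> - s)" "0 \<le> exp (b * s) * x powr (\<theta> + s)"
    "0 \<le> exp (- b * \<theta>) * (if exp (- a) \<le> x then 1 else 0)" by auto
  consider "y < - a" | "- b < y" | "- a \<le> y" "y \<le> - b" by linarith
  then show ?thesis
  proof cases
    case 1
    have "y * \<theta> \<le> - a * s + y * (\<theta> - s)"
      using mult_right_mono[of y "- a" s] 1 s by (simp add: algebra_simps)
    then have "x powr \<theta> \<le> exp (- a * s) * x powr (\<theta> - s)"
      by (simp add: xy powr_def mult.commute flip: exp_add)
    then show ?thesis using nn by linarith
  next
    case 2
    have "y * \<theta> \<le> b * s + y * (\<theta> + s)"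
      using mult_right_mono[of "- b" y s] 2 s by (simp add: algebra_simps)
    then have "x powr \<theta> \<le> exp (b * s) * x powr (\<theta> + s)"
      by (simp add: xy powr_def mult.commute flip: exp_add)
    then show ?thesis using nn by linarith
  next
    case 3
    have "y * \<theta> \<le> - b * \<theta>" using 3 \<theta> by (intro mult_right_mono) auto
    then have "x powr \<theta> \<le> exp (- b * \<theta>)"
      by (simp add: xy powr_def mult.commute)
    moreover have "exp (- a) \<le> x" using 3 by (simp add: xy)
    ultimately have "x powr \<theta> \<le> exp (- b * \<theta>) * (if exp (- a) \<le> x then 1 else 0)" by simp
    then show ?thesis using nn by linarith
  qed
qed (use assms in auto)

text \<open>Words with letters below \<open>n\<close> exhaust all words of a given length by finite sets.\<close>

lemma nn_integral_words_gt_imp_finite: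
  fixes f :: "nat list \<Rightarrow> ennreal"
  assumes "x < (\<integral>\<^sup>+i. f i \<partial>count_space {i. length i = K})"
  obtains F where "finite F" "\<And>i. i \<in> F \<Longrightarrow> length i = K" "x < (\<Sum>i\<in>F. f i)"
proof -
  define F where "F n = {i::nat list. set i \<subseteq> {..<n} \<and> length i = K}" for n
  have fin: "finite (F n)" for n unfolding F_def by (rule finite_lists_length_eq) simp
  have mono: "F n \<subseteq> F m" if "n \<le> m" for n m using that by (force simp: F_def)
  let ?W = "count_space {i::nat list. length i = K}"
  have "(\<integral>\<^sup>+i. f i \<partial>?W) = (\<integral>\<^sup>+i. (SUP n. f i * indicator (F n) i) \<partial>?W)"
  proof (rule nn_integral_cong)
    fix i assume i: "i \<in> space ?W"
    have "i \<in> F (Suc (Max (insert 0 (set i))))"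
      using i by (auto simp: F_def less_Suc_eq_le)
    then have "f i \<le> (SUP n. f i * indicator (F n) i)"
      by (intro SUP_upper2[of "Suc (Max (insert 0 (set i)))"]) auto
    moreover have "(SUP n. f i * indicator (F n) i) \<le> f i"
      by (intro SUP_least) (auto simp: indicator_def)
    ultimately show "f i = (SUP n. f i * indicator (F n) i)" by (rule antisym)
  qed
  also have "\<dots> = (SUP n. \<integral>\<^sup>+i. f i * indicator (F n) i \<partial>?W)"
    by (rule nn_integral_monotone_convergence_SUP)
       (use mono in \<open>auto simp: incseq_def le_fun_def indicator_def\<close>)
  also have "(\<lambda>n. \<integral>\<^sup>+i. f i * indicator (F n) i \<partial>?W) = (\<lambda>n. \<Sum>i\<in>F n. f i)"
  proof
    fix n
    have "(\<integral>\<^sup>+i. f i * indicator (F n) i \<partial>?W) = (\<Sum>i\<in>F n. f i * indicator (F n) i)"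
      by (rule nn_integral_count_space'[OF fin]) (auto simp: F_def)
    then show "(\<integral>\<^sup>+i. f i * indicator (F n) i \<partial>?W) = (\<Sum>i\<in>F n. f i)" by simp
  qed
  finally obtain n where "x < (\<Sum>i\<in>F n. f i)" using assms by (auto simp: less_SUP_iff)
  then show thesis by (intro that[of "F n"] fin) (auto simp: F_def)
qed

context splitting_law
begin

text \<open>The pointwise bound, summed over the masses of generation \<open>K\<close>: with at most one heavy box in the mean, the middle
  part contributes at most \<open>exp (- b * \<theta>) ^ K\<close>.\<close>

lemma moment_split:
  assumes low: "theta_low \<nu> < \<theta> - s" and s: "0 < s"
    and N: "(\<integral>\<^sup>+i. emeasure env {e\<in>space env. exp (- a * K) \<le> mass e i} \<partial>count_space {i. length i = K}) \<le> 1"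
  shows "ellr \<nu> \<theta> ^ K \<le> exp (- b * \<theta>) ^ K + (exp (- a * s) * ellr \<nu> (\<theta> - s)) ^ K + (exp (b * s) * ellr \<nu> (\<theta> + s)) ^ K"
proof -
  let ?W = "count_space {i::nat list. length i = K}"
  have \<theta>: "0 < \<theta>" using low s theta_low_bounds(1) by linarith
  let ?I = "\<lambda>e i. if exp (- a * K) \<le> mass e i then 1 else 0 :: real"
  have "ell \<nu> \<theta> ^ K = (\<integral>\<^sup>+e. \<integral>\<^sup>+i. ennreal (mass e i powr \<theta>) \<partial>?W \<partial>env)"
    by (simp add: moment_masses)
  also have "\<dots> \<le> (\<integral>\<^sup>+e. \<integral>\<^sup>+i. ennreal (exp (- b * \<theta>) ^ K) * indicator {e\<in>space env. exp (- a * K) \<le> mass e i} e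
      + ennreal (exp (- a * s) ^ K) * ennreal (mass e i powr (\<theta> - s)) + ennreal (exp (b * s) ^ K) * ennreal (mass e i powr (\<theta> + s)) \<partial>?W \<partial>env)"
  proof (intro nn_integral_mono)
    fix e i assume e: "e \<in> space env"
    have "ennreal (mass e i powr \<theta>) \<le> ennreal (exp (- (b * K) * \<theta>) * ?I e i + exp (- (a * K) * s) * mass e i powr (\<theta> - s) + exp ((b * K) * s) * mass e i powr (\<theta> + s))"
      using powr_split_bound[OF mass_bounds(1)[OF e] s \<theta>, of i "b * K" "a * K"] by (intro ennreal_leI) simp
    also have "\<dots> = ennreal (exp (- b * \<theta>) ^ K) * indicator {e\<in>space env. exp (- a * K) \<le> mass e i} e
      + ennreal (exp (- a * s) ^ K) * ennreal (mass e i powr (\<theta> - s)) + ennreal (exp (b * s) ^ K) * ennreal (mass e i powr (\<theta> + s))"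
      using e by (auto simp: ennreal_mult exp_of_nat_mult[symmetric] mult_ac indicator_def)
    finally show "ennreal (mass e i powr \<theta>) \<le> ennreal (exp (- b * \<theta>) ^ K) * indicator {e\<in>space env. exp (- a * K) \<le> mass e i} e
      + ennreal (exp (- a * s) ^ K) * ennreal (mass e i powr (\<theta> - s)) + ennreal (exp (b * s) ^ K) * ennreal (mass e i powr (\<theta> + s))" .
  qed
  also have "\<dots> = (\<integral>\<^sup>+i. \<integral>\<^sup>+e. ennreal (exp (- b * \<theta>) ^ K) * indicator {e\<in>space env. exp (- a * K) \<le> mass e i} e
      + ennreal (exp (- a * s) ^ K) * ennreal (mass e i powr (\<theta> - s)) + ennreal (exp (b * s) ^ K) * ennreal (mass e i powr (\<theta> + s)) \<partial>env \<partial>?W)"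
    by (rule nn_integral_count_space_nn_integral) auto
  also have "\<dots> = (\<integral>\<^sup>+i. ennreal (exp (- b * \<theta>) ^ K) * emeasure env {e\<in>space env. exp (- a * K) \<le> mass e i}
      + ennreal (exp (- a * s) ^ K) * (\<integral>\<^sup>+e. ennreal (mass e i powr (\<theta> - s)) \<partial>env) + ennreal (exp (b * s) ^ K) * (\<integral>\<^sup>+e. ennreal (mass e i powr (\<theta> + s)) \<partial>env) \<partial>?W)"
    by (intro nn_integral_cong) (subst nn_integral_add; simp add: nn_integral_add nn_integral_cmult)+
  also have "\<dots> = ennreal (exp (- b * \<theta>) ^ K) * (\<integral>\<^sup>+i. emeasure env {e\<in>space env. exp (- a * K) \<le> mass e i} \<partial>?W)
      + ennreal (exp (- a * s) ^ K) * ell \<nu> (\<theta> - s) ^ K + ennreal (exp (b * s) ^ K) * ell \<nu> (\<theta> + s) ^ K"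
    by (simp add: nn_integral_add nn_integral_cmult moment_masses[symmetric] nn_integral_count_space_nn_integral)
  also have "\<dots> \<le> ennreal (exp (- b * \<theta>) ^ K) * 1
      + ennreal (exp (- a * s) ^ K) * ell \<nu> (\<theta> - s) ^ K + ennreal (exp (b * s) ^ K) * ell \<nu> (\<theta> + s) ^ K"
    by (intro add_mono mult_left_mono N) auto
  also have "\<dots> = ennreal (exp (- b * \<theta>) ^ K + (exp (- a * s) * ellr \<nu> (\<theta> - s)) ^ K + (exp (b * s) * ellr \<nu> (\<theta> + s)) ^ K)"
    using ennreal_ellr[OF low] ennreal_ellr[of "\<theta> + s"] ellr_pos[OF low] ellr_pos[of "\<theta> + s"] low s
    by (simp add: ennreal_power[symmetric] ennreal_mult power_mult_distrib flip: ennreal_ellr)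
  also have "ell \<nu> \<theta> ^ K = ennreal (ellr \<nu> \<theta> ^ K)"
    using ennreal_ellr[of \<theta>] ellr_pos[of \<theta>] ennreal_power[of "ellr \<nu> \<theta>" K] low s by simp
  finally show ?thesis using ellr_pos[OF low] ellr_pos[of "\<theta> + s"] low s
    by (subst (asm) ennreal_le_iff) (auto intro!: add_nonneg_nonneg zero_le_power)
qed

text \<open>With \<open>b < mm \<nu> \<theta> < a\<close> and \<open>b\<close> close to \<open>mm \<nu> \<theta>\<close>, all three terms of \<open>moment_split\<close> are exponentially
  smaller than \<open>l(\<theta>) ^ K\<close>: the middle one by \<open>phi \<nu> \<theta> > 0\<close>, the tails because \<open>ln l\<close> has slope
  \<open>- mm \<nu> \<theta>\<close> at \<open>\<theta>\<close>.\<close>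

lemma supercritical_block:
  assumes low: "theta_low \<nu> < \<theta>" and phi: "0 < phi \<nu> \<theta>" and a: "mm \<nu> \<theta> < a"
  obtains K F where "finite F" "\<And>i. i \<in> F \<Longrightarrow> length i = K" "0 < K"
    "1 < (\<Sum>i\<in>F. env.prob {e\<in>space env. exp (- a * K) \<le> mass e i})"
proof -
  have \<theta>: "0 < \<theta>" using low theta_low_bounds(1) by linarith
  define l where "l = ellr \<nu> \<theta>"
  have l: "0 < l" using ellr_pos[OF low] by (simp add: l_def)
  \<comment> \<open>Chosen so that \<open>ln l(\<theta>) + b * \<theta> = phi \<nu> \<theta> / 2 > 0\<close>.\<close>
  define b where "b = mm \<nu> \<theta> - phi \<nu> \<theta> / (2 * \<theta>)"
  have b: "b < mm \<nu> \<theta>" using phi \<theta> by (simp add: b_def)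
  have dl: "ell_deriv \<theta> = - mm \<nu> \<theta> * l" using l by (simp add: mm_eq low l_def)
  have "\<exists>d>0. \<forall>h>0. h < d \<longrightarrow> exp (- a * h) * ellr \<nu> (\<theta> - h) < l"
  proof -
    have "((\<lambda>h. exp (- a * h) * ellr \<nu> (\<theta> - h)) has_real_derivative (mm \<nu> \<theta> - a) * l) (at 0)"
      using DERIV_ellr[of "\<theta> - 0"] low dl
      by (auto intro!: derivative_eq_intros DERIV_chain'[where g="ellr \<nu>"] simp: l_def algebra_simps)
    moreover have "(mm \<nu> \<theta> - a) * l < 0" using a l by (simp add: mult_neg_pos)
    ultimately show ?thesis using DERIV_neg_dec_right by (fastforce simp: l_def)
  qed
  then obtain d1 where d1: "0 < d1" "\<And>h. 0 < h \<Longrightarrow> h < d1 \<Longrightarrow> exp (- a * h) * ellr \<nu> (\<theta> - h) < l" by blast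
  have "\<exists>d>0. \<forall>h>0. h < d \<longrightarrow> exp (b * h) * ellr \<nu> (\<theta> + h) < l"
  proof -
    have "((\<lambda>h. exp (b * h) * ellr \<nu> (\<theta> + h)) has_real_derivative (b - mm \<nu> \<theta>) * l) (at 0)"
      using DERIV_ellr[of "\<theta> + 0"] low dl
      by (auto intro!: derivative_eq_intros DERIV_chain'[where g="ellr \<nu>"] simp: l_def algebra_simps)
    moreover have "(b - mm \<nu> \<theta>) * l < 0" using b l by (simp add: mult_neg_pos)
    ultimately show ?thesis using DERIV_neg_dec_right by (fastforce simp: l_def)
  qed
  then obtain d2 where d2: "0 < d2" "\<And>h. 0 < h \<Longrightarrow> h < d2 \<Longrightarrow> exp (b * h) * ellr \<nu> (\<theta> + h) < l" by blast
  define s where "s = Min {d1, d2, \<theta> - theta_low \<nu>} / 2"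
  have "0 < Min {d1, d2, \<theta> - theta_low \<nu>}" using d1 d2 low by simp
  then have s: "0 < s" "s < d1" "s < d2" "theta_low \<nu> < \<theta> - s" by (auto simp: s_def min_def field_simps split: if_splits)
  define r1 r2 r3 where "r1 = exp (- b * \<theta>) / l"
    and "r2 = exp (- a * s) * ellr \<nu> (\<theta> - s) / l" and "r3 = exp (b * s) * ellr \<nu> (\<theta> + s) / l"
  have "- b * \<theta> < ln l"
  proof -
    have "b * \<theta> = \<theta> * mm \<nu> \<theta> - phi \<nu> \<theta> / 2" using \<theta> by (simp add: b_def field_simps)
    then show ?thesis using phi phi_eq[OF low] by (simp add: l_def)
  qed
  then have "exp (- b * \<theta>) < l" using l by (metis exp_less_cancel_iff exp_ln)
  then have r: "0 \<le> r1" "r1 < 1" "0 \<le> r2" "r2 < 1" "0 \<le> r3" "r3 < 1"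
    using l d1(2)[OF s(1,2)] d2(2)[OF s(1,3)] ellr_pos[OF s(4)] ellr_pos[of "\<theta> + s"] low s(1)
    by (auto simp: r1_def r2_def r3_def)
  have "(\<lambda>K. r1 ^ K + r2 ^ K + r3 ^ K) \<longlonglongrightarrow> 0 + 0 + 0"
    using r by (intro tendsto_add LIMSEQ_realpow_zero)
  then have "eventually (\<lambda>K. r1 ^ K + r2 ^ K + r3 ^ K < 1 \<and> 0 < K) sequentially"
    by (intro eventually_conj eventually_gt_at_top order_tendstoD(2)) auto
  then obtain K where K: "r1 ^ K + r2 ^ K + r3 ^ K < 1" "0 < K" by (auto simp: eventually_sequentially)
  have gt: "1 < (\<integral>\<^sup>+i. emeasure env {e\<in>space env. exp (- a * K) \<le> mass e i} \<partial>count_space {i. length i = K})"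
  proof (rule ccontr, unfold not_less)
    assume "(\<integral>\<^sup>+i. emeasure env {e\<in>space env. exp (- a * K) \<le> mass e i} \<partial>count_space {i. length i = K}) \<le> 1"
    from moment_split[OF s(4,1) this, of b]
    have "l ^ K \<le> (r1 * l) ^ K + (r2 * l) ^ K + (r3 * l) ^ K"
      using l by (simp add: r1_def r2_def r3_def l_def[symmetric])
    also have "\<dots> = (r1 ^ K + r2 ^ K + r3 ^ K) * l ^ K" by (simp add: power_mult_distrib algebra_simps)
    also have "\<dots> < 1 * l ^ K" using K l by (intro mult_strict_right_mono) auto
    finally show False by simp
  qed
  obtain F where F: "finite F" "\<And>i. i \<in> F \<Longrightarrow> length i = K"
    "1 < (\<Sum>i\<in>F. emeasure env {e\<in>space env. exp (- a * K) \<le> mass e i})"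
    using nn_integral_words_gt_imp_finite[OF gt] by blast
  define S where "S = (\<Sum>i\<in>F. env.prob {e\<in>space env. exp (- a * K) \<le> mass e i})"
  have "(\<Sum>i\<in>F. emeasure env {e\<in>space env. exp (- a * K) \<le> mass e i}) = ennreal S"
    unfolding S_def env.emeasure_eq_measure by (rule sum_ennreal) simp
  then have "1 < ennreal S" using F(3) by (simp only:)
  then have "1 < S" by (simp add: one_less_ennreal)
  with F(1,2) K(2) show thesis unfolding S_def by (rule that)
qed

end

section \<open>Balls thrown at random masses\<close>

lemma space_boundary [simp]: "space boundary = UNIV"
  by (simp add: boundary_def space_PiM)

lemma cylinder_sets [measurable]: "cylinder i \<in> sets boundary"
proof -
  have [measurable]: "(\<lambda>x. x l) \<in> boundary \<rightarrow>\<^sub>M count_space UNIV" for l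
    unfolding boundary_def by measurable
  have "{x\<in>space boundary. \<forall>l<length i. x l = i ! l} \<in> sets boundary" by measurable
  then show ?thesis by (simp add: cylinder_def)
qed

locale occupancy = prob_space M for M :: "'w measure" +
  fixes P :: "'w \<Rightarrow> (nat \<Rightarrow> nat) measure" and lam :: "nat \<Rightarrow> 'w \<Rightarrow> nat \<Rightarrow> nat"
  assumes P [measurable]: "P \<in> M \<rightarrow>\<^sub>M prob_algebra boundary"
    and iid: "cond_iid M boundary P lam"
begin

lemma lam_measurable [measurable]: "lam m \<in> M \<rightarrow>\<^sub>M boundary"
  using iid by (simp add: cond_iid_def)

lemma prob_space_P: "\<omega> \<in> space M \<Longrightarrow> prob_space (P \<omega>)"
  using measurable_space[OF P] by (auto simp: space_prob_algebra)

lemma space_P: "\<omega> \<in> space M \<Longrightarrow> space (P \<omega>) = UNIV"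
  using measurable_space[OF P, of \<omega>] by (auto simp: space_prob_algebra dest: sets_eq_imp_space_eq)

abbreviation "q i \<omega> \<equiv> measure (P \<omega>) (cylinder i)"

lemma q_bounds: "\<omega> \<in> space M \<Longrightarrow> 0 \<le> q i \<omega>" "\<omega> \<in> space M \<Longrightarrow> q i \<omega> \<le> 1"
  using prob_space.prob_le_1[OF prob_space_P] by auto

text \<open>The defining property of conditional probability, integrated over an event that is determined by the random
  measure.\<close>

lemma prob_conditional:
  assumes B: "B \<in> sets (prob_algebra boundary)" and A: "\<And>m. m < n \<Longrightarrow> A m \<in> sets boundary"
  shows "prob {\<omega>\<in>space M. P \<omega> \<in> B \<and> (\<forall>m<n. lam m \<omega> \<in> A m)} =
    (\<integral>\<omega>. indicator B (P \<omega>) * (\<Prod>m<n. measure (P \<omega>) (A m)) \<partial>M)"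
proof -
  note [measurable] = B A
  let ?F = "vimage_algebra (space M) P (prob_algebra boundary)"
  have sub: "subalgebra M ?F"
    using P by (auto simp: subalgebra_def measurable_iff_sets)
  interpret F: finite_measure_subalgebra M ?F
    by unfold_locales (rule sub)
  define E where "E = {\<omega> \<in> space M. \<forall>m<n. lam m \<omega> \<in> A m}"
  have [measurable]: "E \<in> sets M" unfolding E_def by measurable
  have intE: "integrable M (indicator E :: 'w \<Rightarrow> real)" by (simp add: less_top[symmetric])
  define V where "V = P -` B \<inter> space M"
  have VF: "V \<in> sets ?F" unfolding V_def by (rule in_vimage_algebra[OF B])
  have [measurable]: "V \<in> sets M" using VF sub by (auto simp: subalgebra_def)
  have ce: "AE \<omega> in M. real_cond_exp M ?F (indicator E) \<omega> = (\<Prod>m<n. measure (P \<omega>) (A m))"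
    using iid A unfolding cond_iid_def E_def by blast
  have "prob (V \<inter> E) = (\<integral>\<omega>\<in>V. indicator E \<omega> \<partial>M)"
    unfolding set_lebesgue_integral_def by (simp flip: indicator_inter_arith)
  also have "\<dots> = (\<integral>\<omega>\<in>V. real_cond_exp M ?F (indicator E) \<omega> \<partial>M)"
    by (rule F.real_cond_exp_intA[OF intE VF])
  also have "\<dots> = (\<integral>\<omega>. indicator B (P \<omega>) * (\<Prod>m<n. measure (P \<omega>) (A m)) \<partial>M)"
    unfolding set_lebesgue_integral_def
  proof (rule integral_cong_AE)
    show "AE \<omega> in M. indicator V \<omega> *\<^sub>R real_cond_exp M ?F (indicator E) \<omega> = indicator B (P \<omega>) * (\<Prod>m<n. measure (P \<omega>) (A m))"
      using ce by (rule AE_mp) (auto intro!: AE_I2 simp: V_def indicator_def)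
  qed measurable
  also have "V \<inter> E = {\<omega>\<in>space M. P \<omega> \<in> B \<and> (\<forall>m<n. lam m \<omega> \<in> A m)}" by (auto simp: V_def E_def)
  finally show ?thesis .
qed

lemma prob_balls_in:
  assumes B: "B \<in> sets (prob_algebra boundary)" and J: "J \<subseteq> {..<n}" and C: "C \<in> sets boundary"
  shows "prob {\<omega>\<in>space M. P \<omega> \<in> B \<and> (\<forall>m\<in>J. lam m \<omega> \<in> C)} =
    (\<integral>\<omega>. indicator B (P \<omega>) * measure (P \<omega>) C ^ card J \<partial>M)"
proof -
  define A where "A m = (if m \<in> J then C else UNIV)" for m
  have "UNIV \<in> sets boundary" using sets.top[of boundary] by simp
  then have "prob {\<omega>\<in>space M. P \<omega> \<in> B \<and> (\<forall>m<n. lam m \<omega> \<in> A m)} =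
    (\<integral>\<omega>. indicator B (P \<omega>) * (\<Prod>m<n. measure (P \<omega>) (A m)) \<partial>M)"
    using C by (intro prob_conditional[OF B]) (auto simp: A_def)
  also have "{\<omega>\<in>space M. P \<omega> \<in> B \<and> (\<forall>m<n. lam m \<omega> \<in> A m)} = {\<omega>\<in>space M. P \<omega> \<in> B \<and> (\<forall>m\<in>J. lam m \<omega> \<in> C)}"
    using J by (auto simp: A_def)
  also have "(\<integral>\<omega>. indicator B (P \<omega>) * (\<Prod>m<n. measure (P \<omega>) (A m)) \<partial>M) = (\<integral>\<omega>. indicator B (P \<omega>) * measure (P \<omega>) C ^ card J \<partial>M)"
  proof (intro Bochner_Integration.integral_cong refl)
    fix \<omega> assume \<omega>: "\<omega> \<in> space M"
    have "measure (P \<omega>) UNIV = 1" using prob_space.prob_space[OF prob_space_P[OF \<omega>]] space_P[OF \<omega>] by simp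
    then have "(\<Prod>m<n. measure (P \<omega>) (A m)) = (\<Prod>m<n. if m \<in> J then measure (P \<omega>) C else 1)"
      by (intro prod.cong) (auto simp: A_def)
    also have "\<dots> = (\<Prod>m\<in>J. measure (P \<omega>) C)"
      using J by (subst prod.inter_restrict[symmetric]) (auto simp: Int_absorb1)
    finally show "indicator B (P \<omega>) * (\<Prod>m<n. measure (P \<omega>) (A m)) = indicator B (P \<omega>) * measure (P \<omega>) C ^ card J" by simp
  qed
  finally show ?thesis .
qed

abbreviation "load n i \<omega> \<equiv> card {m. m < n \<and> lam m \<omega> \<in> cylinder i}"

lemma load_gt_iff: "j < load n i \<omega> \<longleftrightarrow> (\<exists>J\<in>{J. J \<subseteq> {..<n} \<and> card J = Suc j}. \<forall>m\<in>J. lam m \<omega> \<in> cylinder i)"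
proof
  assume "j < load n i \<omega>"
  then obtain J where "J \<subseteq> {m. m < n \<and> lam m \<omega> \<in> cylinder i}" "card J = Suc j"
    using obtain_subset_with_card_n[of "Suc j" "{m. m < n \<and> lam m \<omega> \<in> cylinder i}"] by auto
  then show "\<exists>J\<in>{J. J \<subseteq> {..<n} \<and> card J = Suc j}. \<forall>m\<in>J. lam m \<omega> \<in> cylinder i" by blast
next
  assume "\<exists>J\<in>{J. J \<subseteq> {..<n} \<and> card J = Suc j}. \<forall>m\<in>J. lam m \<omega> \<in> cylinder i"
  then obtain J where J: "J \<subseteq> {..<n}" "card J = Suc j" "\<forall>m\<in>J. lam m \<omega> \<in> cylinder i" by blast
  then have "card J \<le> load n i \<omega>" by (intro card_mono) auto
  then show "j < load n i \<omega>" using J by simp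
qed

lemma finite_choices [simp]: "finite {J. J \<subseteq> {..<n::nat} \<and> card J = k}"
  by (rule finite_subset[of _ "Pow {..<n}"]) auto

lemma measurable_load_gt [measurable]: "Measurable.pred M (\<lambda>\<omega>. j < load n i \<omega>)"
  unfolding load_gt_iff by (intro pred_intros_finite) (auto intro: finite_subset)

text \<open>When \<open>n * q < 1\<close>, a union bound over the sets of \<open>j + 1\<close> balls gives \<open>(n * q) ^ (j + 1) \<le> (n * q) powr \<theta>\<close>;
  otherwise \<open>(n * q) powr \<theta>\<close> is at least \<open>1\<close>.\<close>

lemma prob_load_gt:
  assumes \<theta>: "0 < \<theta>" "\<theta> \<le> real (Suc j)"
  shows "prob {\<omega>\<in>space M. j < load n i \<omega>} \<le> (\<integral>\<omega>. (n * q i \<omega>) powr \<theta> \<partial>M)"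
proof -
  let ?f = "\<lambda>\<omega>. (n * q i \<omega>) powr \<theta>"
  define B where "B = {\<mu>\<in>space (prob_algebra boundary). n * measure \<mu> (cylinder i) < 1}"
  have B [measurable]: "B \<in> sets (prob_algebra boundary)" unfolding B_def by measurable
  define V where "V = {\<omega>\<in>space M. n * q i \<omega> < 1}"
  have [measurable]: "V \<in> sets M" unfolding V_def by measurable
  have VB: "P \<omega> \<in> B \<longleftrightarrow> \<omega> \<in> V" if "\<omega> \<in> space M" for \<omega>
    using that measurable_space[OF P that] by (auto simp: B_def V_def)
  define G where "G = {\<omega>\<in>space M. j < load n i \<omega>}"
  have [measurable]: "G \<in> sets M" unfolding G_def by measurable
  have f_le: "?f \<omega> \<le> real n powr \<theta>" if "\<omega> \<in> space M" for \<omega>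
    using q_bounds[OF that, of i] \<theta> by (intro powr_mono2) (auto intro: mult_left_le)
  have int: "integrable M ?f"
    by (rule integrable_const_bound[where B="real n powr \<theta>"]) (use f_le in auto)
  have intV: "integrable M (\<lambda>\<omega>. indicator V \<omega> * ?f \<omega>)" "integrable M (\<lambda>\<omega>. indicator (space M - V) \<omega> * ?f \<omega>)"
    using integrable_mult_indicator[OF _ int, of V] integrable_mult_indicator[OF _ int, of "space M - V"] by auto
  let ?J = "{J. J \<subseteq> {..<n} \<and> card J = Suc j}"
  have "G \<inter> V = (\<Union>J\<in>?J. {\<omega>\<in>space M. P \<omega> \<in> B \<and> (\<forall>m\<in>J. lam m \<omega> \<in> cylinder i)})"
    using VB by (auto simp: G_def load_gt_iff V_def)
  also have "prob \<dots> \<le> (\<Sum>J\<in>?J. prob {\<omega>\<in>space M. P \<omega> \<in> B \<and> (\<forall>m\<in>J. lam m \<omega> \<in> cylinder i)})"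
    by (rule finite_measure_subadditive_finite)
       (auto intro!: measurable pred_intros_countable_bounded)
  also have "\<dots> = (\<Sum>J\<in>?J. \<integral>\<omega>. indicator B (P \<omega>) * q i \<omega> ^ Suc j \<partial>M)"
    by (intro sum.cong refl) (subst prob_balls_in[OF B, where n=n], auto)
  also have "\<dots> = (n choose Suc j) * (\<integral>\<omega>. indicator B (P \<omega>) * q i \<omega> ^ Suc j \<partial>M)"
    by (simp add: n_subsets)
  also have "\<dots> \<le> real n ^ Suc j * (\<integral>\<omega>. indicator B (P \<omega>) * q i \<omega> ^ Suc j \<partial>M)"
  proof (rule mult_right_mono)
    show "real (n choose Suc j) \<le> real n ^ Suc j"
    proof (cases "Suc j \<le> n")
      case True
      then show ?thesis using binomial_le_pow[OF True] by (metis of_nat_le_iff of_nat_power)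
    qed (simp add: binomial_eq_0)
    show "0 \<le> (\<integral>\<omega>. indicator B (P \<omega>) * q i \<omega> ^ Suc j \<partial>M)"
      by (intro integral_nonneg_AE AE_I2) auto
  qed
  also have "\<dots> = (\<integral>\<omega>. indicator B (P \<omega>) * (n * q i \<omega>) ^ Suc j \<partial>M)"
    by (subst integral_mult_right_zero[symmetric]) (simp add: power_mult_distrib mult_ac)
  also have "\<dots> \<le> (\<integral>\<omega>. indicator V \<omega> * ?f \<omega> \<partial>M)"
  proof (rule integral_mono'[OF intV(1)])
    fix \<omega> assume \<omega>: "\<omega> \<in> space M"
    show "indicator B (P \<omega>) * (n * q i \<omega>) ^ Suc j \<le> indicator V \<omega> * ?f \<omega>"
    proof (cases "\<omega> \<in> V")
      case True
      then have x: "0 \<le> n * q i \<omega>" "n * q i \<omega> < 1" by (auto simp: V_def)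
      have "(n * q i \<omega>) ^ Suc j \<le> ?f \<omega>"
      proof (cases "n * q i \<omega> = 0")
        case False
        then have "(n * q i \<omega>) ^ Suc j = (n * q i \<omega>) powr real (Suc j)" using x by (subst powr_realpow) linarith+
        also have "\<dots> \<le> ?f \<omega>" using x \<theta> by (intro powr_mono') auto
        finally show ?thesis .
      qed auto
      then show ?thesis using True VB[OF \<omega>] by simp
    qed (use VB[OF \<omega>] in auto)
  qed auto
  finally have 1: "prob (G \<inter> V) \<le> (\<integral>\<omega>. indicator V \<omega> * ?f \<omega> \<partial>M)" .
  have "prob (G - V) \<le> prob (space M - V)"
    by (rule finite_measure_mono) (auto simp: G_def)
  also have "\<dots> = (\<integral>\<omega>. indicator (space M - V) \<omega> \<partial>M)" by simp
  also have "\<dots> \<le> (\<integral>\<omega>. indicator (space M - V) \<omega> * ?f \<omega> \<partial>M)"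
  proof (rule integral_mono[OF _ intV(2)])
    show "integrable M (indicator (space M - V) :: 'w \<Rightarrow> real)" by (simp add: less_top[symmetric])
    fix \<omega> assume \<omega>: "\<omega> \<in> space M"
    show "indicator (space M - V) \<omega> \<le> indicator (space M - V) \<omega> * ?f \<omega>"
      using \<theta> ge_one_powr_ge_zero[of "n * q i \<omega>" \<theta>] by (auto simp: V_def indicator_def)
  qed
  finally have 2: "prob (G - V) \<le> (\<integral>\<omega>. indicator (space M - V) \<omega> * ?f \<omega> \<partial>M)" .
  have "prob G = prob (G \<inter> V) + prob (G - V)"
    by (subst finite_measure_Union[symmetric]) (auto intro: arg_cong[where f=prob])
  also have "\<dots> \<le> (\<integral>\<omega>. indicator V \<omega> * ?f \<omega> \<partial>M) + (\<integral>\<omega>. indicator (space M - V) \<omega> * ?f \<omega> \<partial>M)"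
    using 1 2 by linarith
  also have "\<dots> = (\<integral>\<omega>. indicator V \<omega> * ?f \<omega> + indicator (space M - V) \<omega> * ?f \<omega> \<partial>M)"
    using intV by simp
  also have "\<dots> = (\<integral>\<omega>. ?f \<omega> \<partial>M)"
    by (intro Bochner_Integration.integral_cong) (auto simp: indicator_def)
  finally show ?thesis by (simp add: G_def)
qed

lemma emeasure_overfull:
  assumes \<theta>: "0 < \<theta>" "\<theta> \<le> real (Suc j)"
  shows "emeasure M {\<omega>\<in>space M. \<exists>i. length i = k \<and> j < load n i \<omega>} \<le>
    ennreal (real n powr \<theta>) * (\<integral>\<^sup>+\<omega>. \<integral>\<^sup>+i. ennreal (q i \<omega> powr \<theta>) \<partial>count_space {i. length i = k} \<partial>M)"
proof -
  let ?W = "{i::nat list. length i = k}"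
  define G where "G i = {\<omega>\<in>space M. j < load n i \<omega>}" for i
  have [measurable]: "G i \<in> sets M" for i unfolding G_def by measurable
  define U where "U = (\<Union>i\<in>?W. G i)"
  have [measurable]: "U \<in> sets M" unfolding U_def by (intro sets.countable_UN'') auto
  have "emeasure M U = (\<integral>\<^sup>+\<omega>. indicator U \<omega> \<partial>M)" by simp
  also have "\<dots> \<le> (\<integral>\<^sup>+\<omega>. \<integral>\<^sup>+i. indicator (G i) \<omega> \<partial>count_space ?W \<partial>M)"
  proof (rule nn_integral_mono)
    fix \<omega>
    show "indicator U \<omega> \<le> (\<integral>\<^sup>+i. indicator (G i) \<omega> \<partial>count_space ?W)"
    proof (cases "\<omega> \<in> U")
      case True
      then obtain i where "i \<in> ?W" "\<omega> \<in> G i" by (auto simp: U_def)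
      then show ?thesis using nn_integral_ge_point[of i ?W "\<lambda>i. indicator (G i) \<omega>"] True by simp
    qed simp
  qed
  also have "\<dots> = (\<integral>\<^sup>+i. emeasure M (G i) \<partial>count_space ?W)"
    by (subst nn_integral_count_space_nn_integral) auto
  also have "\<dots> \<le> (\<integral>\<^sup>+i. \<integral>\<^sup>+\<omega>. ennreal (real n powr \<theta>) * ennreal (q i \<omega> powr \<theta>) \<partial>M \<partial>count_space ?W)"
  proof (rule nn_integral_mono)
    fix i
    have "emeasure M (G i) \<le> ennreal (\<integral>\<omega>. (n * q i \<omega>) powr \<theta> \<partial>M)"
      unfolding emeasure_eq_measure G_def by (intro ennreal_leI prob_load_gt \<theta>)
    also have "\<dots> \<le> (\<integral>\<^sup>+\<omega>. ennreal ((n * q i \<omega>) powr \<theta>) \<partial>M)"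
      by (simp add: integral_eq_nn_integral ennreal_enn2real_if)
    also have "\<dots> = (\<integral>\<^sup>+\<omega>. ennreal (real n powr \<theta>) * ennreal (q i \<omega> powr \<theta>) \<partial>M)"
      by (intro nn_integral_cong) (simp add: powr_mult ennreal_mult)
    finally show "emeasure M (G i) \<le> \<dots>" .
  qed
  also have "\<dots> = ennreal (real n powr \<theta>) * (\<integral>\<^sup>+i. \<integral>\<^sup>+\<omega>. ennreal (q i \<omega> powr \<theta>) \<partial>M \<partial>count_space ?W)"
    by (simp add: nn_integral_cmult)
  also have "\<dots> = ennreal (real n powr \<theta>) * (\<integral>\<^sup>+\<omega>. \<integral>\<^sup>+i. ennreal (q i \<omega> powr \<theta>) \<partial>count_space ?W \<partial>M)"
    by (subst nn_integral_count_space_nn_integral) auto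
  finally show ?thesis by (simp add: U_def G_def Collect_bex_eq[symmetric] conj_commute) 
qed

text \<open>Bernoulli: \<open>(1 - y) ^ g * (1 + g * y) \<le> (1 - y^2) ^ g \<le> 1\<close>.  The polynomial decay is enough for summability
  along exponential sequences.\<close>

lemma power_one_minus_bound:
  fixes x y :: real
  assumes "0 < x" "x \<le> y" "y \<le> 1" "0 < g"
  shows "(1 - y) ^ g \<le> 1 / (g * x)"
proof -
  have "(1 - y) ^ g * (1 + g * y) \<le> (1 - y) ^ g * (1 + y) ^ g"
    using assms by (intro mult_left_mono Bernoulli_inequality) auto
  also have "\<dots> = (1 - y\<^sup>2) ^ g"
    by (simp add: power_mult_distrib[symmetric] power2_eq_square algebra_simps)
  also have "\<dots> \<le> 1" using assms by (intro power_le_one) (auto simp: power2_eq_square mult_le_one)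
  finally have "(1 - y) ^ g * (1 + g * y) \<le> 1" .
  moreover have "(1 - y) ^ g * (g * x) \<le> (1 - y) ^ g * (1 + g * y)"
    using assms by (intro mult_left_mono) (auto intro: add_increasing mult_left_mono)
  ultimately show ?thesis using assms by (simp add: field_simps)
qed

text \<open>Cut the balls into \<open>j + 1\<close> groups of size \<open>g\<close>.  A box with at most \<open>j\<close> balls is missed by a whole group, which
  has conditional probability \<open>(1 - q) ^ g\<close>; this avoids any binomial tail estimate.\<close>

lemma prob_load_le:
  assumes B: "B \<in> sets (prob_algebra boundary)" and x: "0 < x" "0 < g"
    and Bx: "\<And>\<mu>. \<mu> \<in> B \<Longrightarrow> x \<le> measure \<mu> (cylinder i)"
  shows "prob {\<omega>\<in>space M. P \<omega> \<in> B \<and> load (Suc j * g) i \<omega> \<le> j} \<le> Suc j / (g * x) * prob {\<omega>\<in>space M. P \<omega> \<in> B}"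
proof -
  note [measurable] = B
  define J where "J r = {r * g..<Suc r * g}" for r
  have Jsub: "J r \<subseteq> {..<Suc j * g}" if "r \<le> j" for r
  proof
    fix m assume "m \<in> J r"
    then have "m < Suc r * g" by (simp only: J_def atLeastLessThan_iff)
    also have "\<dots> \<le> Suc j * g" using that by (intro mult_le_mono1) simp
    finally show "m \<in> {..<Suc j * g}" by (simp only: lessThan_iff)
  qed
  define H where "H r = {\<omega>\<in>space M. P \<omega> \<in> B \<and> (\<forall>m\<in>J r. lam m \<omega> \<in> UNIV - cylinder i)}" for r
  have [measurable]: "H r \<in> sets M" for r
  proof -
    have "H r = {\<omega>\<in>space M. P \<omega> \<in> B \<and> (\<forall>m\<in>J r. \<not> lam m \<omega> \<in> cylinder i)}" by (auto simp: H_def)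
    also have "\<dots> \<in> sets M" by (measurable) (auto simp: J_def)
    finally show ?thesis .
  qed
  have "{\<omega>\<in>space M. P \<omega> \<in> B \<and> load (Suc j * g) i \<omega> \<le> j} \<subseteq> (\<Union>r\<in>{..j}. H r)"
  proof safe
    fix \<omega> assume \<omega>: "\<omega> \<in> space M" "P \<omega> \<in> B" and le: "load (Suc j * g) i \<omega> \<le> j"
    show "\<omega> \<in> (\<Union>r\<in>{..j}. H r)"
    proof (rule ccontr)
      assume "\<omega> \<notin> (\<Union>r\<in>{..j}. H r)"
      then have "\<forall>r. \<exists>m. r \<le> j \<longrightarrow> m \<in> J r \<and> lam m \<omega> \<in> cylinder i"
        using \<omega> by (auto simp: H_def)
      then obtain f where f: "\<And>r. r \<le> j \<Longrightarrow> f r \<in> J r" "\<And>r. r \<le> j \<Longrightarrow> lam (f r) \<omega> \<in> cylinder i" by metis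
      have fdiv: "f r div g = r" if "r \<le> j" for r
        using f(1)[OF that] by (intro div_nat_eqI) (auto simp: J_def mult.commute)
      then have "inj_on f {..j}" by (intro inj_onI) (metis atMost_iff)
      then have "Suc j = card (f ` {..j})" by (simp add: card_image)
      also have "\<dots> \<le> load (Suc j * g) i \<omega>"
      proof (rule card_mono)
        have "f r < Suc j * g" if "r \<le> j" for r
          using f(1)[OF that] Jsub[OF that] by (meson lessThan_iff subsetD)
        then show "f ` {..j} \<subseteq> {m. m < Suc j * g \<and> lam m \<omega> \<in> cylinder i}"
          using f(2) by blast
      qed simp
      finally show False using le by simp
    qed
  qed
  then have "prob {\<omega>\<in>space M. P \<omega> \<in> B \<and> load (Suc j * g) i \<omega> \<le> j} \<le> prob (\<Union>r\<in>{..j}. H r)"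
    by (intro finite_measure_mono) auto
  also have "\<dots> \<le> (\<Sum>r\<in>{..j}. prob (H r))"
    by (rule finite_measure_subadditive_finite) auto
  also have "\<dots> \<le> (\<Sum>r\<in>{..j}. 1 / (g * x) * prob {\<omega>\<in>space M. P \<omega> \<in> B})"
  proof (rule sum_mono)
    fix r assume "r \<in> {..j}"
    then have r: "r \<le> j" by simp
    have sB: "UNIV - cylinder i \<in> sets boundary" using sets.compl_sets[OF cylinder_sets[of i]] by simp
    have "prob (H r) = (\<integral>\<omega>. indicator B (P \<omega>) * measure (P \<omega>) (UNIV - cylinder i) ^ card (J r) \<partial>M)"
      unfolding H_def by (rule prob_balls_in[OF B Jsub[OF r] sB])
    also have "\<dots> \<le> (\<integral>\<omega>. indicator B (P \<omega>) * (1 / (g * x)) \<partial>M)"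
    proof (rule integral_mono')
      show "integrable M (\<lambda>\<omega>. indicator B (P \<omega>) * (1 / (g * x)))"
        by (intro integrable_const_bound[where B="1 / (g * x)"]) (use x in \<open>auto simp: indicator_def\<close>)
      fix \<omega> assume \<omega>: "\<omega> \<in> space M"
      have "measure (P \<omega>) (UNIV - cylinder i) = 1 - q i \<omega>"
        using prob_space.prob_compl[OF prob_space_P[OF \<omega>], of "cylinder i"] space_P[OF \<omega>] measurable_space[OF P \<omega>]
        by (simp add: space_prob_algebra)
      moreover have "P \<omega> \<in> B \<Longrightarrow> (1 - q i \<omega>) ^ g \<le> 1 / (g * x)"
        using x q_bounds[OF \<omega>] Bx by (intro power_one_minus_bound) auto
      ultimately show "indicator B (P \<omega>) * measure (P \<omega>) (UNIV - cylinder i) ^ card (J r) \<le> indicator B (P \<omega>) * (1 / (g * x))"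
        by (auto simp: J_def indicator_def)
    qed (use x in auto)
    also have "\<dots> = 1 / (g * x) * (\<integral>\<omega>. indicator {\<omega>\<in>space M. P \<omega> \<in> B} \<omega> \<partial>M)"
      by (subst integral_mult_right_zero[symmetric], intro Bochner_Integration.integral_cong) (auto simp: indicator_def)
    finally show "prob (H r) \<le> 1 / (g * x) * prob {\<omega>\<in>space M. P \<omega> \<in> B}" by simp
  qed
  also have "\<dots> = Suc j / (g * x) * prob {\<omega>\<in>space M. P \<omega> \<in> B}" by simp
  finally show ?thesis .
qed

text \<open>Follow the first heavy box in a fixed enumeration of words.  Its index is determined by the random measure, so the
  conditional estimate applies on each of the disjoint events that fix the index.\<close>

lemma prob_heavy_box_underfull:
  assumes x: "0 < x" "0 < g"
  shows "prob {\<omega>\<in>space M. (\<exists>i. length i = k \<and> x \<le> q i \<omega>) \<and> (\<forall>i. length i = k \<longrightarrow> load (Suc j * g) i \<omega> \<le> j)} \<le> Suc j / (g * x)"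
proof -
  define w :: "nat \<Rightarrow> nat list" where "w = from_nat"
  define h where "h N \<mu> \<longleftrightarrow> length (w N) = k \<and> x \<le> measure \<mu> (cylinder (w N))" for N and \<mu> :: "(nat \<Rightarrow> nat) measure"
  define B where "B N = {\<mu>\<in>space (prob_algebra boundary). h N \<mu> \<and> (\<forall>N'<N. \<not> h N' \<mu>)}" for N
  have B [measurable]: "B N \<in> sets (prob_algebra boundary)" for N unfolding B_def h_def by measurable
  define Q where "Q N = {\<omega>\<in>space M. P \<omega> \<in> B N}" for N
  have [measurable]: "Q N \<in> sets M" for N unfolding Q_def by measurable
  define C where "C N = {\<omega>\<in>space M. P \<omega> \<in> B N \<and> load (Suc j * g) (w N) \<omega> \<le> j}" for N
  have [measurable]: "C N \<in> sets M" for N unfolding C_def not_less[symmetric] by measurable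
  define c where "c = Suc j / (g * x)"
  have c: "0 \<le> c" using x by (simp add: c_def)
  have Cle: "prob (C N) \<le> c * prob (Q N)" for N
    unfolding C_def Q_def c_def by (rule prob_load_le[OF B x]) (auto simp: B_def h_def)
  have "disjoint_family Q"
  proof -
    have "N = N'" if "\<omega> \<in> Q N" "\<omega> \<in> Q N'" for \<omega> N N'
      using that by (cases N N' rule: linorder_cases) (auto simp: Q_def B_def)
    then show ?thesis by (auto simp: disjoint_family_on_def)
  qed
  then have sQ: "(\<lambda>N. prob (Q N)) sums prob (\<Union>N. Q N)" by (intro finite_measure_UNION) auto
  have sC: "summable (\<lambda>N. prob (C N))"
    using Cle by (intro summable_comparison_test[OF _ summable_mult[OF sums_summable[OF sQ], of c]]) auto
  have "prob {\<omega>\<in>space M. (\<exists>i. length i = k \<and> x \<le> q i \<omega>) \<and> (\<forall>i. length i = k \<longrightarrow> load (Suc j * g) i \<omega> \<le> j)} \<le> prob (\<Union>N. C N)"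
  proof (rule finite_measure_mono)
    show "{\<omega>\<in>space M. (\<exists>i. length i = k \<and> x \<le> q i \<omega>) \<and> (\<forall>i. length i = k \<longrightarrow> load (Suc j * g) i \<omega> \<le> j)} \<subseteq> (\<Union>N. C N)"
    proof safe
      fix \<omega> i assume \<omega>: "\<omega> \<in> space M" and i: "x \<le> q i \<omega>" "k = length i"
        and le: "\<forall>i'. length i' = length i \<longrightarrow> load (Suc j * g) i' \<omega> \<le> j"
      have "h (to_nat i) (P \<omega>)" using i by (simp add: h_def w_def)
      then obtain N where N: "h N (P \<omega>)" "\<forall>N'<N. \<not> h N' (P \<omega>)"
        using exists_least_iff[of "\<lambda>N. h N (P \<omega>)"] by blast
      then have "\<omega> \<in> C N" using \<omega> le measurable_space[OF P \<omega>] i by (auto simp: C_def B_def h_def)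
      then show "\<omega> \<in> (\<Union>N. C N)" by blast
    qed
  qed auto
  also have "\<dots> \<le> (\<Sum>N. prob (C N))"
    by (rule finite_measure_subadditive_countably) (auto intro: sC)
  also have "\<dots> \<le> (\<Sum>N. c * prob (Q N))"
    by (intro suminf_le Cle sC summable_mult sums_summable[OF sQ])
  also have "\<dots> = c * prob (\<Union>N. Q N)"
    using sums_mult[OF sQ, of c] by (simp add: sums_iff)
  also have "\<dots> \<le> c * 1" using c by (intro mult_left_mono) auto
  finally show ?thesis by (simp add: c_def)
qed

end

section \<open>The lowest generation without overfull boxes\<close>

text \<open>Only boxes visited by one of the \<open>n\<close> balls can be overfull, so the cardinality is that of a finite set.\<close>

lemma overfull_boxes_eq_0_iff:
  "overfull_boxes lam \<omega> n (int j) k = 0 \<longleftrightarrow> (\<forall>i. length i = k \<longrightarrow> card {m. m < n \<and> lam m \<omega> \<in> cylinder i} \<le> j)"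
proof -
  let ?S = "{i. length i = k \<and> int (card {m. m < n \<and> lam m \<omega> \<in> cylinder i}) > int j}"
  have "?S \<subseteq> (\<lambda>m. map (lam m \<omega>) [0..<k]) ` {..<n}"
  proof
    fix i assume i: "i \<in> ?S"
    then have "{m. m < n \<and> lam m \<omega> \<in> cylinder i} \<noteq> {}" by (metis (no_types, lifting) card.empty mem_Collect_eq not_less of_nat_0 of_nat_0_le_iff)
    then obtain m where m: "m < n" "lam m \<omega> \<in> cylinder i" by blast
    then have "i = map (lam m \<omega>) [0..<k]" using i by (auto simp: cylinder_def intro!: nth_equalityI)
    then show "i \<in> (\<lambda>m. map (lam m \<omega>) [0..<k]) ` {..<n}" using m by blast
  qed
  then have "finite ?S" by (rule finite_subset) simp
  then show ?thesis unfolding overfull_boxes_def by (auto simp: not_less)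
qed

lemma zeta_le:
  assumes "1 \<le> k" "\<And>i. length i = k \<Longrightarrow> card {m. m < n \<and> lam m \<omega> \<in> cylinder i} \<le> j"
  shows "zeta lam \<omega> n (int j) \<le> k"
  unfolding zeta_def using assms by (intro cInf_lower) (auto simp: overfull_boxes_eq_0_iff)

text \<open>A box with more than \<open>j\<close> balls makes all its ancestors overfull; the generation \<open>k'\<close> ensures that the infimum is
  taken over a nonempty set.\<close>

lemma zeta_gt:
  assumes i: "length i = k" "j < card {m. m < n \<and> lam m \<omega> \<in> cylinder i}"
    and fin: "1 \<le> k'" "\<And>i. length i = k' \<Longrightarrow> card {m. m < n \<and> lam m \<omega> \<in> cylinder i} \<le> j"
  shows "k < zeta lam \<omega> n (int j)"
proof -
  let ?Z = "{k. 1 \<le> k \<and> overfull_boxes lam \<omega> n (int j) k = 0}"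
  have "k' \<in> ?Z" using fin by (auto simp: overfull_boxes_eq_0_iff)
  then have Z: "zeta lam \<omega> n (int j) \<in> ?Z" unfolding zeta_def by (intro Inf_nat_def1) blast
  show ?thesis
  proof (rule ccontr)
    assume "\<not> ?thesis"
    then have le: "zeta lam \<omega> n (int j) \<le> k" by simp
    define i' where "i' = take (zeta lam \<omega> n (int j)) i"
    have "card {m. m < n \<and> lam m \<omega> \<in> cylinder i} \<le> card {m. m < n \<and> lam m \<omega> \<in> cylinder i'}"
      by (intro card_mono) (auto simp: cylinder_def i'_def)
    moreover have "length i' = zeta lam \<omega> n (int j)" using le i by (simp add: i'_def)
    ultimately show False using Z i(2) by (force simp: overfull_boxes_eq_0_iff)
  qed
qed

text \<open>Given \<open>n\<close>, the first hypothesis is used at the smallest generation \<open>k\<close> with \<open>n \<le> exp (a * k)\<close> and the second at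
  the largest \<open>k\<close> with \<open>C * exp (a * k) \<le> n\<close>.  The rates \<open>m * (1 \<plusminus> 1 / (p + 2))\<close> form sequences so that the
  hypotheses can hold almost surely for all of them at once.\<close>

lemma growth_rate_limit:
  fixes Z :: "nat \<Rightarrow> nat" and m C :: real
  assumes m: "0 < m" and C: "0 < C"
    and upper: "\<And>p::nat. eventually (\<lambda>k. \<forall>n. real n \<le> exp (m * (1 - 1 / (p + 2)) * k) \<longrightarrow> Z n \<le> k) sequentially"
    and lower: "\<And>p::nat. eventually (\<lambda>k. \<forall>n. C * exp (m * (1 + 1 / (p + 2)) * k) \<le> real n \<longrightarrow> k < Z n) sequentially"
  shows "(\<lambda>n. real (Z n) / ln (real n)) \<longlonglongrightarrow> 1 / m"
proof -
  have ln_top: "filterlim (\<lambda>n. ln (real n)) at_top sequentially"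
    by (rule filterlim_compose[OF ln_at_top filterlim_real_sequentially])
  have ln_pos: "eventually (\<lambda>n. 0 < ln (real n)) sequentially"
    using ln_top by (simp add: filterlim_at_top_dense)
  have inv0: "(\<lambda>n. c / ln (real n)) \<longlonglongrightarrow> 0" for c :: real
    by (rule tendsto_divide_0[OF tendsto_const]) (rule filterlim_at_top_imp_at_infinity[OF ln_top])
  have up: "eventually (\<lambda>n. real (Z n) / ln (real n) \<le> 1 / (m * (1 - 1 / (p + 2))) + 1 / ln (real n)) sequentially" for p :: nat
  proof -
    define a where "a = m * (1 - 1 / (p + 2))"
    have a: "0 < a" unfolding a_def by (rule mult_pos_pos) (use m in \<open>auto simp: field_simps\<close>)
    obtain K :: nat where K: "\<And>(k::nat) n. K \<le> k \<Longrightarrow> real n \<le> exp (a * k) \<Longrightarrow> Z n \<le> k"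
      using upper[of p] by (auto simp: eventually_sequentially a_def)
    have "eventually (\<lambda>n. a * K \<le> ln (real n)) sequentially" using ln_top by (simp add: filterlim_at_top)
    then show ?thesis
      using ln_pos eventually_gt_at_top[of 0]
    proof eventually_elim
      case (elim n)
      define k where "k = nat \<lceil>ln (real n) / a\<rceil>"
      have k: "ln (real n) / a \<le> k" "k \<le> ln (real n) / a + 1"
        using elim a by (auto simp: k_def) 
      have "real K \<le> ln (real n) / a" using elim a by (simp add: field_simps)
      then have "K \<le> k" using k by linarith
      moreover have "ln (real n) \<le> a * k" using k a by (simp add: field_simps)
      then have "real n \<le> exp (a * k)" using elim by (metis exp_le_cancel_iff exp_ln of_nat_0_less_iff)
      ultimately have "Z n \<le> k" by (rule K)
      then have "real (Z n) \<le> ln (real n) / a + 1" using k by linarith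
      then have "real (Z n) / ln (real n) \<le> (ln (real n) / a + 1) / ln (real n)"
        using elim by (intro divide_right_mono) auto
      also have "\<dots> = 1 / a + 1 / ln (real n)" using elim a by (simp add: field_simps)
      finally show ?case by (simp add: a_def)
    qed
  qed
  have lo: "eventually (\<lambda>n. 1 / (m * (1 + 1 / (p + 2))) - (ln C / (m * (1 + 1 / (p + 2))) + 1) / ln (real n) \<le> real (Z n) / ln (real n)) sequentially" for p :: nat
  proof -
    define a where "a = m * (1 + 1 / (p + 2))"
    have a: "0 < a" using m by (simp add: a_def add_pos_pos)
    obtain K :: nat where K: "\<And>(k::nat) n. K \<le> k \<Longrightarrow> C * exp (a * k) \<le> real n \<Longrightarrow> k < Z n"
      using lower[of p] by (auto simp: eventually_sequentially a_def)
    have "eventually (\<lambda>n. a * (K + 1) + ln C \<le> ln (real n)) sequentially" using ln_top by (simp add: filterlim_at_top)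
    then show ?thesis
      using ln_pos eventually_gt_at_top[of 0]
    proof eventually_elim
      case (elim n)
      define y where "y = (ln (real n) - ln C) / a"
      have y: "K + 1 \<le> y" using elim a by (simp add: y_def field_simps)
      define k where "k = nat \<lfloor>y\<rfloor>"
      have k: "real k \<le> y" "y - 1 \<le> k" using y by (auto simp: k_def) 
      have "K \<le> k" using y k by linarith
      moreover have "C * exp (a * k) \<le> real n"
      proof -
        have "ln C + a * k \<le> ln (real n)" using k a by (simp add: y_def field_simps)
        then have "exp (ln C + a * k) \<le> exp (ln (real n))" by simp
        then show ?thesis using C elim by (simp add: exp_add)
      qed
      ultimately have "k < Z n" by (rule K)
      then have "y - 1 \<le> real (Z n)" using k by linarith
      then have "(y - 1) / ln (real n) \<le> real (Z n) / ln (real n)"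
        using elim by (intro divide_right_mono) auto
      moreover have "(y - 1) / ln (real n) = 1 / a - (ln C / a + 1) / ln (real n)"
        using elim a by (simp add: y_def field_simps)
      ultimately show ?case by (simp add: a_def)
    qed
  qed
  have seq: "(\<lambda>p. 1 / real (p + 2)) \<longlonglongrightarrow> 0"
    using LIMSEQ_ignore_initial_segment[OF lim_1_over_n, of 2] by simp
  show ?thesis
  proof (rule order_tendstoI)
    fix y assume y: "1 / m < y"
    have "(\<lambda>p. 1 / (m * (1 - 1 / real (p + 2)))) \<longlonglongrightarrow> 1 / (m * (1 - 0))"
      using m by (intro tendsto_intros seq) auto
    then have "eventually (\<lambda>p. 1 / (m * (1 - 1 / real (p + 2))) < y) sequentially"
      using y by (intro order_tendstoD(2)) auto
    then obtain p where p: "1 / (m * (1 - 1 / real (p + 2))) < y" by (auto simp: eventually_sequentially)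
    have "(\<lambda>n. 1 / (m * (1 - 1 / real (p + 2))) + 1 / ln (real n)) \<longlonglongrightarrow> 1 / (m * (1 - 1 / real (p + 2))) + 0"
      by (intro tendsto_intros inv0)
    then have "eventually (\<lambda>n. 1 / (m * (1 - 1 / real (p + 2))) + 1 / ln (real n) < y) sequentially"
      using p by (intro order_tendstoD(2)) auto
    with up[of p] show "eventually (\<lambda>n. real (Z n) / ln (real n) < y) sequentially"
      by eventually_elim (simp add: add.commute)
  next
    fix y assume y: "y < 1 / m"
    have "(\<lambda>p. 1 / (m * (1 + 1 / real (p + 2)))) \<longlonglongrightarrow> 1 / (m * (1 + 0))"
      using m by (intro tendsto_intros seq) auto
    then have "eventually (\<lambda>p. y < 1 / (m * (1 + 1 / real (p + 2)))) sequentially"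
      using y by (intro order_tendstoD(1)) auto
    then obtain p where p: "y < 1 / (m * (1 + 1 / real (p + 2)))" by (auto simp: eventually_sequentially)
    have "(\<lambda>n. 1 / (m * (1 + 1 / real (p + 2))) - (ln C / (m * (1 + 1 / real (p + 2))) + 1) / ln (real n)) \<longlonglongrightarrow> 1 / (m * (1 + 1 / real (p + 2))) - 0"
      by (intro tendsto_intros inv0)
    then have "eventually (\<lambda>n. y < 1 / (m * (1 + 1 / real (p + 2))) - (ln C / (m * (1 + 1 / real (p + 2))) + 1) / ln (real n)) sequentially"
      using p by (intro order_tendstoD(1)) auto
    with lo[of p] show "eventually (\<lambda>n. y < real (Z n) / ln (real n)) sequentially"
      by eventually_elim (simp add: add.commute)
  qed
qed

locale cascade_occupancy = splitting_law \<nu> + occupancy M P lam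
  for \<nu> and M :: "'w measure" and P lam +
  fixes rho :: "nat list \<Rightarrow> 'w \<Rightarrow> nat \<Rightarrow> real"
  assumes rho_indep: "indep_vars (\<lambda>_. Prob_N) rho UNIV"
    and rho_law: "\<And>i. distr M Prob_N (rho i) = \<nu>"
    and rho_mass: "AE \<omega> in M. \<forall>i. q i \<omega> = cascade_mass rho \<omega> i"
begin

definition env_of :: "'w \<Rightarrow> nat list \<Rightarrow> nat \<Rightarrow> real" where
  "env_of \<omega> v = rho v \<omega>"

lemma rho_measurable [measurable]: "rho v \<in> M \<rightarrow>\<^sub>M \<nu>"
proof -
  have "rho v \<in> M \<rightarrow>\<^sub>M Prob_N" using rho_indep by (auto simp: indep_vars_def)
  then show ?thesis by (simp add: measurable_cong_sets[OF refl sets_law])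
qed

lemma env_of_measurable [measurable]: "env_of \<in> M \<rightarrow>\<^sub>M env"
  unfolding env_def env_of_def[abs_def]
  by (rule measurable_PiM_single') (auto simp: measurable_space[OF rho_measurable])

text \<open>This transfers almost sure statements from the canonical space of environments to the given probability space.\<close>

lemma distr_env_of: "distr M env env_of = env"
proof -
  have rv: "random_variable Prob_N (rho v)" for v using rho_indep by (auto simp: indep_vars_def)
  have "distr M (Pi\<^sub>M UNIV (\<lambda>_. Prob_N)) (\<lambda>x. \<lambda>i\<in>UNIV. rho i x) = Pi\<^sub>M UNIV (\<lambda>i. distr M Prob_N (rho i))"
    using rho_indep by (subst indep_vars_iff_distr_eq_PiM'[symmetric]) (auto simp: rv)
  moreover have "distr M env env_of = distr M (Pi\<^sub>M UNIV (\<lambda>_. Prob_N)) (\<lambda>x. \<lambda>i\<in>UNIV. rho i x)"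
  proof (rule distr_cong)
    show "sets env = sets (Pi\<^sub>M UNIV (\<lambda>_. Prob_N))"
      unfolding env_def by (rule sets_PiM_cong) (simp_all add: sets_law)
  qed (auto simp: env_of_def fun_eq_iff)
  ultimately show ?thesis by (simp add: rho_law env_def)
qed

lemma AE_mass: "AE \<omega> in M. \<forall>i. q i \<omega> = mass (env_of \<omega>) i"
  using rho_mass by (simp add: cascade_mass_def mass_def env_of_def)

lemma moment_boxes:
  "(\<integral>\<^sup>+\<omega>. \<integral>\<^sup>+i. ennreal (q i \<omega> powr \<theta>) \<partial>count_space {i. length i = k} \<partial>M) = ell \<nu> \<theta> ^ k"
proof -
  have "(\<integral>\<^sup>+\<omega>. ennreal (q i \<omega> powr \<theta>) \<partial>M) = (\<integral>\<^sup>+e. ennreal (mass e i powr \<theta>) \<partial>env)" for i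
  proof -
    have "(\<integral>\<^sup>+\<omega>. ennreal (q i \<omega> powr \<theta>) \<partial>M) = (\<integral>\<^sup>+\<omega>. ennreal (mass (env_of \<omega>) i powr \<theta>) \<partial>M)"
      using AE_mass by (intro nn_integral_cong_AE) (auto elim: eventually_mono)
    also have "\<dots> = (\<integral>\<^sup>+e. ennreal (mass e i powr \<theta>) \<partial>distr M env env_of)"
      by (subst nn_integral_distr) auto
    finally show ?thesis by (simp add: distr_env_of)
  qed
  then show ?thesis
    using moment_masses[where \<theta>=\<theta> and k=k]
    by (subst nn_integral_count_space_nn_integral)
       (simp_all add: nn_integral_count_space_nn_integral)
qed

text \<open>Here the expected number of overfull boxes is at most \<open>exp (- (m - a) * \<theta> * k)\<close>.\<close>

lemma eventually_no_overfull:
  assumes \<theta>: "1 < \<theta>" "\<theta> \<le> real (Suc j)" and ell: "ellr \<nu> \<theta> = exp (- \<theta> * m)" and a: "a < m"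
  shows "AE \<omega> in M. eventually (\<lambda>k. \<forall>i. length i = k \<longrightarrow> load (nat \<lfloor>exp (a * k)\<rfloor>) i \<omega> \<le> j) sequentially"
proof -
  define A where "A k = {\<omega>\<in>space M. \<exists>i. length i = k \<and> j < load (nat \<lfloor>exp (a * k)\<rfloor>) i \<omega>}" for k
  define r where "r = exp (- (m - a) * \<theta>)"
  have r: "0 \<le> r" "r < 1" using a \<theta> by (auto simp: r_def mult_neg_pos)
  have [measurable]: "A k \<in> sets M" for k unfolding A_def by measurable
  have "prob (A k) \<le> r ^ k" for k
  proof -
    define n where "n = nat \<lfloor>exp (a * k)\<rfloor>"
    have "real n powr \<theta> \<le> exp (a * k) powr \<theta>"
      using \<theta> by (intro powr_mono2) (auto simp: n_def)
    also have "\<dots> = exp (a * \<theta>) ^ k" by (simp add: powr_def exp_of_nat_mult[symmetric] mult_ac)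
    finally have n: "real n powr \<theta> \<le> exp (a * \<theta>) ^ k" .
    have "ennreal (prob (A k)) \<le> ennreal (real n powr \<theta>) * ell \<nu> \<theta> ^ k"
      using emeasure_overfull[of \<theta> j k n] \<theta> by (simp add: A_def n_def moment_boxes emeasure_eq_measure)
    also have "\<dots> \<le> ennreal (exp (a * \<theta>) ^ k) * ell \<nu> \<theta> ^ k" by (intro mult_right_mono ennreal_leI n) simp
    also have "ell \<nu> \<theta> ^ k = ennreal (exp (- \<theta> * m) ^ k)"
      using ennreal_ellr[of \<theta>] theta_low_bounds(2) \<theta> ell by (simp add: ennreal_power[symmetric])
    also have "ennreal (exp (a * \<theta>) ^ k) * ennreal (exp (- \<theta> * m) ^ k) = ennreal (r ^ k)"
      by (simp add: r_def ennreal_mult[symmetric] power_mult_distrib[symmetric] exp_add[symmetric] algebra_simps)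
    finally show ?thesis using r by (simp add: ennreal_le_iff)
  qed
  then have "summable (\<lambda>k. prob (A k))"
    using r by (intro summable_comparison_test[OF _ summable_geometric[of r]]) auto
  then have "AE \<omega> in M. eventually (\<lambda>k. \<omega> \<in> space M - A k) sequentially"
    by (intro borel_cantelli_AE1) (auto simp: less_top[symmetric])
  then show ?thesis
  proof (rule AE_mp, intro AE_I2 impI)
    fix \<omega> assume "eventually (\<lambda>k. \<omega> \<in> space M - A k) sequentially"
    then show "eventually (\<lambda>k. \<forall>i. length i = k \<longrightarrow> load (nat \<lfloor>exp (a * k)\<rfloor>) i \<omega> \<le> j) sequentially"
      by eventually_elim (auto simp: A_def not_less)
  qed
qed

text \<open>A heavy line with rate \<open>a1\<close> provides boxes of mass \<open>exp (- a2 * k)\<close> for any \<open>a2\<close> strictly between \<open>a1\<close> and \<open>a\<close>,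
  once \<open>k\<close> is large enough to absorb the random constant; each of them expects about \<open>exp ((a - a2) * k)\<close> balls.\<close>

lemma eventually_overfull:
  assumes heavy: "env.prob (heavy_lines a1) = 1" and a: "a1 < a"
  shows "AE \<omega> in M. eventually (\<lambda>k. \<exists>i. length i = k \<and> j < load (Suc j * nat \<lceil>exp (a * k)\<rceil>) i \<omega>) sequentially"
proof -
  define a2 where "a2 = (a1 + a) / 2"
  have a2: "a1 < a2" "a2 < a" using a by (auto simp: a2_def)
  define g where "g k = nat \<lceil>exp (a * real k)\<rceil>" for k
  have g: "exp (a * real k) \<le> g k" "0 < g k" for k by (auto simp: g_def)
  define A where "A k = {\<omega>\<in>space M. (\<exists>i. length i = k \<and> exp (- a2 * k) \<le> q i \<omega>) \<and> (\<forall>i. length i = k \<longrightarrow> load (Suc j * g k) i \<omega> \<le> j)}" for k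
  have [measurable]: "A k \<in> sets M" for k unfolding A_def not_less[symmetric] by measurable
  define r where "r = exp (- (a - a2))"
  have r: "0 \<le> r" "r < 1" using a2 by (auto simp: r_def)
  have "prob (A k) \<le> Suc j * r ^ k" for k
  proof -
    have "prob (A k) \<le> Suc j / (g k * exp (- a2 * k))"
      unfolding A_def by (rule prob_heavy_box_underfull) (use g in auto)
    also have "\<dots> \<le> Suc j / (exp (a * k) * exp (- a2 * k))"
      using g[of k] by (intro divide_left_mono mult_right_mono mult_pos_pos) auto
    also have "exp (a * k) * exp (- a2 * k) = inverse (r ^ k)"
      by (simp add: r_def exp_of_nat_mult[symmetric] exp_add[symmetric] exp_minus[symmetric] algebra_simps)
    also have "Suc j / inverse (r ^ k) = Suc j * r ^ k" by (simp add: field_simps)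
    finally show ?thesis .
  qed
  then have "summable (\<lambda>k. prob (A k))"
    using r by (intro summable_comparison_test[OF _ summable_mult[OF summable_geometric[of r], of "Suc j"]]) auto
  then have 1: "AE \<omega> in M. eventually (\<lambda>k. \<omega> \<in> space M - A k) sequentially"
    by (intro borel_cantelli_AE1) (auto simp: less_top[symmetric])
  have "AE e in env. e \<in> heavy_lines a1"
    using heavy env.AE_prob_1[of "heavy_lines a1"] by simp
  then have "AE e in distr M env env_of. e \<in> heavy_lines a1" by (subst distr_env_of)
  then have 2: "AE \<omega> in M. env_of \<omega> \<in> heavy_lines a1"
    by (subst (asm) AE_distr_iff) auto
  from 1 2 AE_mass show ?thesis
  proof eventually_elim
    case (elim \<omega>)
    obtain m where m: "\<And>k. \<exists>i. length i = k \<and> exp (- a1 * k) / Suc m \<le> mass (env_of \<omega>) i"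
      using elim(2) by (auto simp: heavy_lines_def)
    have "(\<lambda>k. exp (- (a2 - a1)) ^ k) \<longlonglongrightarrow> 0" using a2 by (intro LIMSEQ_realpow_zero) auto
    then have "eventually (\<lambda>k. exp (- (a2 - a1)) ^ k < 1 / Suc m) sequentially"
      by (intro order_tendstoD(2)) auto
    with elim(1) show ?case
    proof eventually_elim
      case (elim k)
      obtain i where i: "length i = k" "exp (- a1 * k) / Suc m \<le> mass (env_of \<omega>) i" using m by blast
      have "exp (- a2 * k) = exp (- a1 * k) * exp (- (a2 - a1)) ^ k"
        by (simp add: exp_of_nat_mult[symmetric] exp_add[symmetric] algebra_simps)
      also have "\<dots> \<le> exp (- a1 * k) * (1 / Suc m)" using elim by (intro mult_left_mono) auto
      also have "\<dots> \<le> q i \<omega>" using i \<open>\<forall>i. q i \<omega> = mass (env_of \<omega>) i\<close> by simp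
      finally show ?case using elim(1) i(1) by (auto simp: A_def g_def not_le)
    qed
  qed
qed

lemma zeta_limit:
  assumes \<theta>: "1 < \<theta>" "\<theta> \<le> real (Suc j)" and ell: "ellr \<nu> \<theta> = exp (- \<theta> * m)" and m: "0 < m"
    and heavy: "\<And>a. m < a \<Longrightarrow> env.prob (heavy_lines a) = 1"
  shows "AE \<omega> in M. (\<lambda>n. real (zeta lam \<omega> n (int j)) / ln (real n)) \<longlonglongrightarrow> 1 / m"
proof -
  define a b where "a p = m * (1 - 1 / (real p + 2))" and "b p = m * (1 + 1 / (real p + 2))" for p
  have a: "0 < a p" for p unfolding a_def by (rule mult_pos_pos) (use m in \<open>auto simp: field_simps\<close>)
  have am: "a p < m" for p using m by (simp add: a_def field_simps)
  have b: "m < b p" for p using m by (simp add: b_def field_simps)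
  have "AE \<omega> in M. \<forall>p. eventually (\<lambda>k. \<forall>i. length i = k \<longrightarrow> load (nat \<lfloor>exp (a p * k)\<rfloor>) i \<omega> \<le> j) sequentially"
    unfolding AE_all_countable by (intro allI eventually_no_overfull[OF \<theta> ell] am)
  moreover have "AE \<omega> in M. \<forall>p. eventually (\<lambda>k. \<exists>i. length i = k \<and> j < load (Suc j * nat \<lceil>exp (b p * k)\<rceil>) i \<omega>) sequentially"
    unfolding AE_all_countable
  proof
    fix p
    have "m < (m + b p) / 2" "(m + b p) / 2 < b p" using b[of p] by auto
    then show "AE \<omega> in M. eventually (\<lambda>k. \<exists>i. length i = k \<and> j < load (Suc j * nat \<lceil>exp (b p * k)\<rceil>) i \<omega>) sequentially"
      by (intro eventually_overfull[OF heavy])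
  qed
  ultimately show ?thesis
  proof eventually_elim
    case (elim \<omega>)
    have load_mono: "load n i \<omega> \<le> load n' i \<omega>" if "n \<le> n'" for n n' and i :: "nat list"
      using that by (intro card_mono) auto
    have fin: "eventually (\<lambda>k. \<forall>n. real n \<le> exp (a p * k) \<longrightarrow> (\<forall>i::nat list. length i = k \<longrightarrow> load n i \<omega> \<le> j)) sequentially" for p
      using elim(1)[rule_format, of p]
    proof eventually_elim
      case (elim k)
      show ?case
      proof (intro allI impI)
        fix n and i :: "nat list" assume n: "real n \<le> exp (a p * k)" and i: "length i = k"
        have "n \<le> nat \<lfloor>exp (a p * k)\<rfloor>" using n by (simp add: le_nat_floor)
        from order_trans[OF load_mono[OF this]] show "load n i \<omega> \<le> j" using elim i by blast
      qed
    qed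
    show ?case
    proof (rule growth_rate_limit[OF m, where C="2 * real (Suc j)"])
      fix p :: nat
      show "eventually (\<lambda>k. \<forall>n. real n \<le> exp (m * (1 - 1 / (p + 2)) * k) \<longrightarrow> zeta lam \<omega> n (int j) \<le> k) sequentially"
        using fin[of p] eventually_ge_at_top[of 1]
      proof eventually_elim
        case (elim k)
        have ak: "m * (1 - 1 / (p + 2)) * k = a p * k" by (simp add: a_def add.commute)
        show ?case unfolding ak using elim by (blast intro: zeta_le)
      qed
      show "eventually (\<lambda>k. \<forall>n. 2 * real (Suc j) * exp (m * (1 + 1 / (p + 2)) * k) \<le> real n \<longrightarrow> k < zeta lam \<omega> n (int j)) sequentially"
        using elim(2)[rule_format, of p]
      proof eventually_elim
        case (elim k)
        then obtain i where i: "length i = k" "j < load (Suc j * nat \<lceil>exp (b p * k)\<rceil>) i \<omega>" by blast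
        show ?case
        proof (intro allI impI)
          fix n assume n: "2 * real (Suc j) * exp (m * (1 + 1 / (p + 2)) * k) \<le> real n"
          have bk: "m * (1 + 1 / (p + 2)) * k = b p * k" by (simp add: b_def add.commute)
          have "0 \<le> b p * k" using b[of p] m by simp
          then have y: "1 \<le> exp (b p * k)" by simp
          have "real (nat \<lceil>y\<rceil>) \<le> 2 * y" if "1 \<le> y" for y :: real
          proof -
            have "real (nat \<lceil>y\<rceil>) = of_int \<lceil>y\<rceil>" using that by simp
            then show ?thesis using of_int_ceiling_le_add_one[of y] that by linarith
          qed
          from this[OF y] have "real (nat \<lceil>exp (b p * k)\<rceil>) \<le> 2 * exp (b p * k)" .
          then have "real (Suc j) * real (nat \<lceil>exp (b p * k)\<rceil>) \<le> real (Suc j) * (2 * exp (b p * k))"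
            by (intro mult_left_mono) auto
          also have "\<dots> = 2 * real (Suc j) * exp (b p * k)" by (simp only: mult.left_commute mult.assoc)
          also have "\<dots> \<le> real n" using n unfolding bk .
          finally have "Suc j * nat \<lceil>exp (b p * k)\<rceil> \<le> n" by (simp only: of_nat_mult[symmetric] of_nat_le_iff)
          then have j: "j < load n i \<omega>" using less_le_trans[OF i(2) load_mono] by blast
          have "filterlim (\<lambda>k. exp (a 0 * real k)) at_top sequentially"
            using a[of 0]
            by (intro filterlim_compose[OF exp_at_top] filterlim_tendsto_pos_mult_at_top[OF tendsto_const] filterlim_real_sequentially)
          then have "eventually (\<lambda>k. real n \<le> exp (a 0 * k)) sequentially" by (simp add: filterlim_at_top)
          with fin[of 0] eventually_ge_at_top[of 1]
          have "eventually (\<lambda>k. 1 \<le> k \<and> (\<forall>i::nat list. length i = k \<longrightarrow> load n i \<omega> \<le> j)) sequentially"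
            by eventually_elim blast
          then obtain k' where k': "1 \<le> k'" "\<And>i::nat list. length i = k' \<Longrightarrow> load n i \<omega> \<le> j"
            by (auto simp: eventually_sequentially)
          show "k < zeta lam \<omega> n (int j)" by (rule zeta_gt[where i=i and k'=k']) (use i(1) j k' in auto)
        qed
      qed
    qed simp
  qed
qed

end

theorem proposition2:
  fixes M :: "'w measure"
    and \<nu> :: "(nat \<Rightarrow> real) measure"
    and rho :: "nat list \<Rightarrow> 'w \<Rightarrow> nat \<Rightarrow> real"
    and P :: "'w \<Rightarrow> (nat \<Rightarrow> nat) measure"
    and lam :: "nat \<Rightarrow> 'w \<Rightarrow> nat \<Rightarrow> nat"
    and j :: int
  assumes "\<nu> \<in> space (prob_algebra Prob_N)"
    and "\<not> geometric_law \<nu>"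
    and "prob_space M"
    and "prob_space.indep_vars M (\<lambda>_. Prob_N) rho UNIV"
    and "\<And>i. distr M Prob_N (rho i) = \<nu>"
    and "P \<in> measurable M (prob_algebra boundary)"
    and "AE \<omega> in M. \<forall>i. measure (P \<omega>) (cylinder i) = cascade_mass rho \<omega> i"
    and "cond_iid M boundary P lam"
    and "theta_up \<nu> \<le> ereal (of_int j + 1)"
  shows "AE \<omega> in M. (\<lambda>n. real (zeta lam \<omega> n j) / ln (real n)) \<longlonglongrightarrow> 1 / mm_lim \<nu>"
proof -
  interpret splitting_law \<nu> by (unfold_locales) (rule assms(1))
  interpret prob_space M by (rule assms(3))
  interpret occupancy M P lam using assms(6,8) by unfold_locales
  interpret cascade_occupancy \<nu> M P lam rho using assms(4,5,7) by unfold_locales auto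
  obtain T where T: "theta_up \<nu> = ereal T" "1 < T" "0 < mm_lim \<nu>"
    "ellr \<nu> T = exp (- T * mm_lim \<nu>)"
    and near: "\<And>\<epsilon>. 0 < \<epsilon> \<Longrightarrow> \<exists>\<theta>. theta_low \<nu> < \<theta> \<and> 0 < phi \<nu> \<theta> \<and> mm \<nu> \<theta> < mm_lim \<nu> + \<epsilon>"
    using critical_exponent[OF assms(2,9)] by metis
  have Tj: "T \<le> of_int j + 1" using assms(9) T(1) by simp
  define jj where "jj = nat j"
  have jj: "j = int jj" using Tj T(2) by (simp add: jj_def)
  obtain i i' where ii: "i \<noteq> i'" "0 < env.prob {e\<in>space env. 0 < e [] i \<and> 0 < e [] i'}"
    using two_atoms[OF assms(2)] by blast
  have "env.prob (heavy_lines a) = 1" if a: "mm_lim \<nu> < a" for a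
  proof -
    obtain \<theta> where \<theta>: "theta_low \<nu> < \<theta>" "0 < phi \<nu> \<theta>" "mm \<nu> \<theta> < a"
    proof -
      from a have "0 < a - mm_lim \<nu>" by simp
      from near[OF this] show thesis using that by auto
    qed
    obtain F K where KF: "finite F" "\<And>i. i \<in> F \<Longrightarrow> length i = K" "0 < K"
      "1 < (\<Sum>i\<in>F. env.prob {e\<in>space env. exp (- a * real K) \<le> mass e i})"
      by (rule supercritical_block[OF \<theta>]) (rule that)
    have "0 < env.prob (heavy_lines a)"
      using T(3) a by (intro prob_heavy_lines_pos[OF _ KF]) linarith
    with ii show ?thesis by (rule prob_heavy_lines_zero_one)
  qed
  note heavy = this
  have "T \<le> real (Suc jj)" using Tj jj by simp
  from zeta_limit[OF T(2) this T(4,3) heavy] show ?thesis unfolding jj .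
qed

end
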